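(* Suppose that $0\le \rho_0,\rho_1,q<1$ and $0<\sigma\le 1$. For each $L\ge 1$ let $(\gamma^{(L)}_0,\dots,\gamma^{(L)}_L)$ be a random Motzkin path of length $L$ chosen according to the probability measure $$\mathbb P_L(\boldsymbol\gamma)=\frac{1}{\mathfrak C_L}\,\rho_0^{\gamma_0}\rho_1^{\gamma_L}(2\sigma)^{H(\boldsymbol\gamma)}\prod_{k=0}^{L}[\gamma_k+1]_q ,$$ let $\boldsymbol\gamma^{(L)}=\{\gamma^{(L)}_k\}_{k\ge 0}$ with $\gamma_k^{(L)}:=0$ for $k>L$, and let $\widetilde{\boldsymbol\gamma}^{(L)}=\{\widetilde\gamma^{(L)}_k\}_{k\ge 0}$ with $\widetilde\gamma^{(L)}_k=\gamma^{(L)}_{L-k}$ for $k=0,\dots,L$ and $\widetilde\gamma^{(L)}_k:=0$ for $k>L$. Then, as $L\to\infty$, $$(\boldsymbol\gamma^{(L)},\widetilde{\boldsymbol\gamma}^{(L)})\Rightarrow(\boldsymbol X,\boldsymbol Y)$$ (weak convergence, i.e. convergence of all finite-dimensional distributions of the pair), where $\boldsymbol X=\{X_k\}_{k\ge0}$ and $\boldsymbol Y=\{Y_k\}_{k\ge0}$ are two independent Markov chains on $\mathbb Z_{\ge0}$ with the same transition probabilities $$\mathbb P(X_k=n+\delta\mid X_{k-1}=n)=\frac{1-q^{n+1}}{1+\sigma}\cdot\begin{cases}\dfrac{s_{n+1}}{2s_n},&\delta=1,\\ \sigma,&\delta=0,\\ \dfrac{s_{n-1}}{2s_n},&\delta=-1,\\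 0,&\text{otherwise},\end{cases}\qquad n=0,1,\dots,$$ and with the initial laws $$\mathbb P(X_0=n)=\frac{1}{C_0}\rho_0^n s_n,\qquad \mathbb P(Y_0=n)=\frac1{C_1}\rho_1^n s_n,\qquad n=0,1,\dots,$$ where $s_{-1}=0$, $$s_n=\sum_{k=0}^n\frac{(a;q)_k}{(q;q)_k}\,\frac{(b;q)_{n-k}}{(q;q)_{n-k}},\quad n=0,1,\dots,$$ with $a=-q(\sigma+\mathrm i\sqrt{1-\sigma^2})$, $b=-q(\sigma-\mathrm i\sqrt{1-\sigma^2})$, and the normalizing constants are $$C_j=\frac{(a\rho_j;q)_\infty(b\rho_j;q)_\infty}{(\rho_j;q)_\infty^2},\quad j=0,1.$$
   Context: A Motzkin path of length $L$ is a sequence $\boldsymbol\gamma=(\gamma_0,\dots,\gamma_L)$ of non-negative integers with $\gamma_j-\gamma_{j-1}\in\{-1,0,1\}$ for $j=1,\dots,L$; the endpoints $\gamma_0,\gamma_L$ are arbitrary non-negative integers. $H(\boldsymbol\gamma)=\#\{j\in\{1,\dots,L\}:\gamma_j=\gamma_{j-1}\}$ is the number of horizontal steps. $[n]_q=1+q+\dots+q^{n-1}$ is the $q$-number. $\mathfrak C_L$ is the normalizing constant making $\mathbb P_L$ a probability measure on the set of all Motzkin paths of length $L$. $q$-Pochhammer symbols: $(a;q)_n=\prod_{k=0}^{n-1}(1-aq^k)$ and $(a;q)_\infty=\prod_{k=0}^\infty(1-aq^k)$. The convention $0^0=1$ is used. *)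

theory Defs
  imports "HOL-Probability.Probability"
begin

definition q_number :: "real \<Rightarrow> nat \<Rightarrow> real" where
  "q_number q n = (\<Sum>i<n. q ^ i)"

definition qpoch :: "complex \<Rightarrow> real \<Rightarrow> nat \<Rightarrow> complex" where
  "qpoch a q n = (\<Prod>k<n. 1 - a * complex_of_real q ^ k)"

definition qpoch_inf :: "complex \<Rightarrow> real \<Rightarrow> complex" where
  "qpoch_inf a q = (\<Prod>k. 1 - a * complex_of_real q ^ k)"


text \<open>A path of length \<open>L\<close> is the list of its \<open>L + 1\<close> heights; both end heights are free.\<close>

definition motzkin_paths :: "nat \<Rightarrow> nat list set" where
  "motzkin_paths L = {\<gamma>. length \<gamma> = L + 1 \<and>
     (\<forall>j\<in>{1..L}. int (\<gamma> ! j) - int (\<gamma> ! (j - 1)) \<in> {-1, 0, 1})}"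

definition horizontal_steps :: "nat \<Rightarrow> nat list \<Rightarrow> nat" where
  "horizontal_steps L \<gamma> = card {j \<in> {1..L}. \<gamma> ! j = \<gamma> ! (j - 1)}"

definition motzkin_weight ::
  "real \<Rightarrow> real \<Rightarrow> real \<Rightarrow> real \<Rightarrow> nat \<Rightarrow> nat list \<Rightarrow> real" where
  "motzkin_weight \<rho>0 \<rho>1 \<sigma> q L \<gamma> =
     \<rho>0 ^ (\<gamma> ! 0) * \<rho>1 ^ (\<gamma> ! L) * (2 * \<sigma>) ^ horizontal_steps L \<gamma>
       * (\<Prod>k\<in>{0..L}. q_number q (\<gamma> ! k + 1))"

definition motzkin_norm :: "real \<Rightarrow> real \<Rightarrow> real \<Rightarrow> real \<Rightarrow> nat \<Rightarrow> real" where
  "motzkin_norm \<rho>0 \<rho>1 \<sigma> q L = (\<Sum>\<^sub>\<infinity>\<gamma>\<in>motzkin_paths L. motzkin_weight \<rho>0 \<rho>1 \<sigma> q L \<gamma>)"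

text \<open>That this is a genuine probability mass function, so that \<open>embed_pmf\<close> is not
  underspecified, is lemma \<open>pmf_motzkin_pmf\<close> below.\<close>

definition motzkin_pmf :: "real \<Rightarrow> real \<Rightarrow> real \<Rightarrow> real \<Rightarrow> nat \<Rightarrow> nat list pmf" where
  "motzkin_pmf \<rho>0 \<rho>1 \<sigma> q L = embed_pmf (\<lambda>\<gamma>.
     if \<gamma> \<in> motzkin_paths L
     then motzkin_weight \<rho>0 \<rho>1 \<sigma> q L \<gamma> / motzkin_norm \<rho>0 \<rho>1 \<sigma> q L else 0)"

definition path_seq :: "nat \<Rightarrow> nat list \<Rightarrow> nat \<Rightarrow> nat" where
  "path_seq L \<gamma> k = (if k \<le> L then \<gamma> ! k else 0)"

definition rev_path_seq :: "nat \<Rightarrow> nat list \<Rightarrow> nat \<Rightarrow> nat" where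
  "rev_path_seq L \<gamma> k = (if k \<le> L then \<gamma> ! (L - k) else 0)"

lemma q_number_bounds:
  assumes "0 \<le> q" "q < 1" "n > 0"
  shows "1 \<le> q_number q n" "q_number q n \<le> 1 / (1 - q)"
proof -
  have "(\<Sum>i\<in>{0}. q ^ i) \<le> (\<Sum>i<n. q ^ i)"
    using assms by (intro sum_mono2) auto
  then show "1 \<le> q_number q n" by (simp add: q_number_def)
  have "(\<Sum>i<n. q ^ i) \<le> (\<Sum>i. q ^ i)"
    using assms by (intro sum_le_suminf summable_geometric) auto
  then show "q_number q n \<le> 1 / (1 - q)"
    using assms by (simp add: q_number_def suminf_geometric)
qed

lemma motzkin_paths_from:
  "finite {\<gamma> \<in> motzkin_paths L. \<gamma> ! 0 = n} \<and> card {\<gamma> \<in> motzkin_paths L. \<gamma> ! 0 = n} \<le> 3 ^ L"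
proof (induction L)
  case 0
  have "{\<gamma> \<in> motzkin_paths 0. \<gamma> ! 0 = n} \<subseteq> {[n]}"
    by (auto simp: motzkin_paths_def length_Suc_conv)
  then show ?case
    using finite_subset card_mono[of "{[n]}"] by auto
next
  case (Suc L)
  let ?P = "{\<gamma> \<in> motzkin_paths L. \<gamma> ! 0 = n}"
  let ?f = "\<lambda>(\<gamma>, d). \<gamma> @ [nat (int (\<gamma> ! L) + d)]"
  have sub: "{\<gamma> \<in> motzkin_paths (Suc L). \<gamma> ! 0 = n} \<subseteq> ?f ` (?P \<times> {-1, 0, 1})"
  proof
    fix \<gamma> assume g: "\<gamma> \<in> {\<gamma> \<in> motzkin_paths (Suc L). \<gamma> ! 0 = n}"
    then have len: "length \<gamma> = Suc (Suc L)"
      and step: "\<And>j. j \<in> {1..Suc L} \<Longrightarrow> int (\<gamma> ! j) - int (\<gamma> ! (j - 1)) \<in> {-1, 0, 1}"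
      and n: "\<gamma> ! 0 = n"
      by (auto simp: motzkin_paths_def)
    have 1: "take (Suc L) \<gamma> \<in> ?P"
      unfolding motzkin_paths_def
    proof (intro CollectI conjI ballI)
      fix j assume j: "j \<in> {1..L}"
      then have "take (Suc L) \<gamma> ! j = \<gamma> ! j" "take (Suc L) \<gamma> ! (j - 1) = \<gamma> ! (j - 1)"
        by auto
      then show "int (take (Suc L) \<gamma> ! j) - int (take (Suc L) \<gamma> ! (j - 1)) \<in> {-1, 0, 1}"
        using step[of j] j by auto
    qed (use len n in auto)
    have 2: "int (\<gamma> ! Suc L) - int (\<gamma> ! L) \<in> {-1, 0, 1}"
      using step[of "Suc L"] by auto
    have "\<gamma> = take (Suc L) \<gamma> @ [\<gamma> ! Suc L]"
      using len take_Suc_conv_app_nth[of "Suc L" \<gamma>] by auto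
    then have 3: "\<gamma> = ?f (take (Suc L) \<gamma>, int (\<gamma> ! Suc L) - int (\<gamma> ! L))"
      by simp
    show "\<gamma> \<in> ?f ` (?P \<times> {-1, 0, 1})"
      using 1 2 by (intro image_eqI[where f = ?f, OF 3]) blast
  qed
  have fin: "finite (?P \<times> {-1, 0, 1 :: int})"
    using Suc by auto
  have "card {\<gamma> \<in> motzkin_paths (Suc L). \<gamma> ! 0 = n} \<le> card (?P \<times> {-1, 0, 1 :: int})"
    using sub fin by (meson card_image_le card_mono finite_imageI le_trans)
  also have "\<dots> \<le> 3 ^ Suc L"
    using Suc by (simp add: card_cartesian_product)
  finally show ?case
    using finite_subset[OF sub] fin by blast
qed

context
  fixes \<rho>0 \<rho>1 \<sigma> q :: real
  assumes par: "0 \<le> \<rho>0" "\<rho>0 < 1" "0 \<le> \<rho>1" "\<rho>1 < 1" "0 \<le> q" "q < 1" "0 < \<sigma>" "\<sigma> \<le> 1"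
begin

lemma motzkin_weight_nonneg: "0 \<le> motzkin_weight \<rho>0 \<rho>1 \<sigma> q L \<gamma>"
  using par by (auto simp: motzkin_weight_def q_number_def intro!: mult_nonneg_nonneg prod_nonneg sum_nonneg add_nonneg_nonneg)

lemma motzkin_weight_le:
  "motzkin_weight \<rho>0 \<rho>1 \<sigma> q L \<gamma> \<le> \<rho>0 ^ (\<gamma> ! 0) * (2 ^ L * (1 / (1 - q)) ^ (L + 1))"
proof -
  have h: "horizontal_steps L \<gamma> \<le> L"
  proof -
    have "card {j \<in> {1..L}. \<gamma> ! j = \<gamma> ! (j - 1)} \<le> card {1..L}"
      by (intro card_mono) auto
    then show ?thesis by (simp add: horizontal_steps_def)
  qed
  have "(2 * \<sigma>) ^ horizontal_steps L \<gamma> \<le> 2 ^ horizontal_steps L \<gamma>"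
    using par by (intro power_mono) auto
  also have "\<dots> \<le> 2 ^ L"
    using h by (intro power_increasing) auto
  finally have 1: "(2 * \<sigma>) ^ horizontal_steps L \<gamma> \<le> 2 ^ L" .
  have "(\<Prod>k\<in>{0..L}. q_number q (\<gamma> ! k + 1)) \<le> (\<Prod>k\<in>{0..L}. 1 / (1 - q))"
    using q_number_bounds[OF par(5,6)] by (intro prod_mono) (auto intro: order_trans[of _ 1])
  then have 2: "(\<Prod>k\<in>{0..L}. q_number q (\<gamma> ! k + 1)) \<le> (1 / (1 - q)) ^ (L + 1)"
    by simp
  have 3: "\<rho>1 ^ (\<gamma> ! L) \<le> 1" using par by (intro power_le_one) auto
  have 0: "0 \<le> (\<Prod>k\<in>{0..L}. q_number q (\<gamma> ! k + 1))"
    using par by (auto simp: q_number_def intro!: prod_nonneg sum_nonneg add_nonneg_nonneg)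
  have "\<rho>1 ^ (\<gamma> ! L) * ((2 * \<sigma>) ^ horizontal_steps L \<gamma> * (\<Prod>k\<in>{0..L}. q_number q (\<gamma> ! k + 1)))
      \<le> 1 * (2 ^ L * (1 / (1 - q)) ^ (L + 1))"
    using 0 par by (intro mult_mono 1 2 3) auto
  then have "\<rho>0 ^ (\<gamma> ! 0) * (\<rho>1 ^ (\<gamma> ! L) * ((2 * \<sigma>) ^ horizontal_steps L \<gamma> * (\<Prod>k\<in>{0..L}. q_number q (\<gamma> ! k + 1))))
      \<le> \<rho>0 ^ (\<gamma> ! 0) * (1 * (2 ^ L * (1 / (1 - q)) ^ (L + 1)))"
    using par by (intro mult_left_mono) auto
  then show ?thesis
    by (simp add: motzkin_weight_def mult.assoc)
qed

lemma motzkin_weight_summable: "motzkin_weight \<rho>0 \<rho>1 \<sigma> q L summable_on motzkin_paths L"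
proof (rule nonneg_bdd_above_summable_on)
  define K where "K = (2::real) ^ L * (1 / (1 - q)) ^ (L + 1)"
  have K: "0 \<le> K" using par by (simp add: K_def)
  show "bdd_above (sum (motzkin_weight \<rho>0 \<rho>1 \<sigma> q L) ` {F. F \<subseteq> motzkin_paths L \<and> finite F})"
  proof (rule bdd_aboveI2)
    fix F assume "F \<in> {F. F \<subseteq> motzkin_paths L \<and> finite F}"
    then have F: "F \<subseteq> motzkin_paths L" "finite F" by auto
    define T where "T = (\<lambda>\<gamma>. \<gamma> ! 0) ` F"
    have T: "finite T" using F by (simp add: T_def)
    have "sum (motzkin_weight \<rho>0 \<rho>1 \<sigma> q L) F \<le> (\<Sum>\<gamma>\<in>F. \<rho>0 ^ (\<gamma> ! 0) * K)"
      unfolding K_def by (intro sum_mono motzkin_weight_le)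
    also have "\<dots> = (\<Sum>n\<in>T. \<Sum>\<gamma>\<in>{\<gamma>\<in>F. \<gamma> ! 0 = n}. \<rho>0 ^ (\<gamma> ! 0) * K)"
      unfolding T_def using F by (intro sum.image_gen)
    also have "\<dots> = (\<Sum>n\<in>T. real (card {\<gamma>\<in>F. \<gamma> ! 0 = n}) * (\<rho>0 ^ n * K))"
      by (intro sum.cong) auto
    also have "\<dots> \<le> (\<Sum>n\<in>T. 3 ^ L * (\<rho>0 ^ n * K))"
    proof (intro sum_mono mult_right_mono)
      fix n
      have "card {\<gamma>\<in>F. \<gamma> ! 0 = n} \<le> card {\<gamma> \<in> motzkin_paths L. \<gamma> ! 0 = n}"
        using F motzkin_paths_from by (intro card_mono) auto
      also have "\<dots> \<le> 3 ^ L" using motzkin_paths_from by blast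
      finally show "real (card {\<gamma>\<in>F. \<gamma> ! 0 = n}) \<le> 3 ^ L"
        by (metis of_nat_le_iff of_nat_numeral of_nat_power)
    qed (use par K in auto)
    also have "\<dots> = (\<Sum>n\<in>T. \<rho>0 ^ n) * (3 ^ L * K)"
      by (simp add: sum_distrib_right sum_distrib_left algebra_simps)
    also have "\<dots> \<le> (\<Sum>n. \<rho>0 ^ n) * (3 ^ L * K)"
      using par K T by (intro mult_right_mono sum_le_suminf summable_geometric) auto
    finally show "sum (motzkin_weight \<rho>0 \<rho>1 \<sigma> q L) F \<le> (\<Sum>n. \<rho>0 ^ n) * (3 ^ L * K)" .
  qed
qed (rule motzkin_weight_nonneg)

lemma motzkin_norm_pos: "0 < motzkin_norm \<rho>0 \<rho>1 \<sigma> q L"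
proof -
  let ?z = "replicate (L + 1) 0"
  have z: "?z \<in> motzkin_paths L"
    by (auto simp: motzkin_paths_def simp del: replicate_Suc replicate.simps)
  have "0 < motzkin_weight \<rho>0 \<rho>1 \<sigma> q L ?z"
    using par by (auto simp: motzkin_weight_def q_number_def simp del: replicate.simps
        intro!: mult_pos_pos prod_pos)
  also have "\<dots> = infsum (motzkin_weight \<rho>0 \<rho>1 \<sigma> q L) {?z}"
    by simp
  also have "\<dots> \<le> motzkin_norm \<rho>0 \<rho>1 \<sigma> q L"
    unfolding motzkin_norm_def
    by (rule infsum_mono_neutral)
      (use z motzkin_weight_summable motzkin_weight_nonneg in auto)
  finally show ?thesis .
qed

lemma pmf_motzkin_pmf:
  "pmf (motzkin_pmf \<rho>0 \<rho>1 \<sigma> q L) \<gamma> =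
     (if \<gamma> \<in> motzkin_paths L
      then motzkin_weight \<rho>0 \<rho>1 \<sigma> q L \<gamma> / motzkin_norm \<rho>0 \<rho>1 \<sigma> q L else 0)"
proof -
  let ?g = "\<lambda>\<gamma>. motzkin_weight \<rho>0 \<rho>1 \<sigma> q L \<gamma> / motzkin_norm \<rho>0 \<rho>1 \<sigma> q L"
  let ?f = "\<lambda>\<gamma>. if \<gamma> \<in> motzkin_paths L then ?g \<gamma> else 0"
  have nonneg: "0 \<le> ?g \<gamma>" for \<gamma>
    using motzkin_weight_nonneg motzkin_norm_pos[of L] by simp
  have sm: "?g summable_on motzkin_paths L"
    unfolding divide_inverse
    by (rule summable_on_cmult_left) (rule motzkin_weight_summable)
  have "(\<lambda>x. norm (?g x)) summable_on motzkin_paths L"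
    using sm nonneg by (simp only: real_norm_def abs_of_nonneg)
  then have abs: "Infinite_Set_Sum.abs_summable_on ?g (motzkin_paths L)"
    by (simp only: abs_summable_equivalent)
  have "infsum ?g (motzkin_paths L) = 1"
    using motzkin_norm_pos[of L] unfolding divide_inverse
    by (subst infsum_cmult_left) (auto simp: motzkin_weight_summable motzkin_norm_def[symmetric])
  then have "nn_integral (count_space (motzkin_paths L)) ?g = 1"
    using nn_integral_conv_infsetsum[OF abs] nonneg infsetsum_infsum[OF abs] by simp
  moreover have "nn_integral (count_space UNIV) ?f = nn_integral (count_space (motzkin_paths L)) ?g"
    by (subst (2) nn_integral_count_space_indicator)
      (auto intro!: nn_integral_cong split: split_indicator)
  ultimately have "nn_integral (count_space UNIV) ?f = 1" by simp
  then show ?thesis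
    unfolding motzkin_pmf_def by (subst pmf_embed_pmf) (auto simp: nonneg)
qed

end


definition param_a :: "real \<Rightarrow> real \<Rightarrow> complex" where
  "param_a \<sigma> q = - complex_of_real q * (complex_of_real \<sigma> + \<i> * complex_of_real (sqrt (1 - \<sigma>\<^sup>2)))"

definition param_b :: "real \<Rightarrow> real \<Rightarrow> complex" where
  "param_b \<sigma> q = - complex_of_real q * (complex_of_real \<sigma> - \<i> * complex_of_real (sqrt (1 - \<sigma>\<^sup>2)))"

text \<open>Integer index, to accommodate \<open>s\<^sub>-\<^sub>1 = 0\<close>. The values are real but are kept
  as complex numbers, since they are given by a formula in complex numbers.\<close>

definition s_seq :: "real \<Rightarrow> real \<Rightarrow> int \<Rightarrow> complex" where
  "s_seq \<sigma> q n = (if n < 0 then 0 else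
     (\<Sum>k\<in>{0..nat n}.
        qpoch (param_a \<sigma> q) q k / qpoch (complex_of_real q) q k *
        (qpoch (param_b \<sigma> q) q (nat n - k) / qpoch (complex_of_real q) q (nat n - k))))"

definition init_const :: "real \<Rightarrow> real \<Rightarrow> real \<Rightarrow> complex" where
  "init_const \<sigma> q \<rho> =
     qpoch_inf (param_a \<sigma> q * complex_of_real \<rho>) q * qpoch_inf (param_b \<sigma> q * complex_of_real \<rho>) q
       / (qpoch_inf (complex_of_real \<rho>) q)\<^sup>2"

definition init_prob :: "real \<Rightarrow> real \<Rightarrow> real \<Rightarrow> nat \<Rightarrow> complex" where
  "init_prob \<sigma> q \<rho> n = 1 / init_const \<sigma> q \<rho> * complex_of_real \<rho> ^ n * s_seq \<sigma> q (int n)"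

definition step_prob :: "real \<Rightarrow> real \<Rightarrow> nat \<Rightarrow> int \<Rightarrow> complex" where
  "step_prob \<sigma> q n \<delta> =
     complex_of_real ((1 - q ^ (n + 1)) / (1 + \<sigma>)) *
       (if \<delta> = 1 then s_seq \<sigma> q (int n + 1) / (2 * s_seq \<sigma> q (int n))
        else if \<delta> = 0 then complex_of_real \<sigma>
        else if \<delta> = -1 then s_seq \<sigma> q (int n - 1) / (2 * s_seq \<sigma> q (int n))
        else 0)"

text \<open>Time-homogeneous Markov chain on the non-negative integers with given initial law and
  transition kernel; the condition on the past is only imposed on histories of positive
  probability.\<close>

definition markov_chain ::
  "'a measure \<Rightarrow> (nat \<Rightarrow> 'a \<Rightarrow> nat) \<Rightarrow> nat pmf \<Rightarrow> (nat \<Rightarrow> nat pmf) \<Rightarrow> bool" where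
  "markov_chain M X \<mu> \<kappa> \<longleftrightarrow>
     prob_space M \<and>
     (\<forall>k. X k \<in> measurable M (count_space UNIV)) \<and>
     (\<forall>n. \<P>(\<omega> in M. X 0 \<omega> = n) = pmf \<mu> n) \<and>
     (\<forall>k x m. \<P>(\<omega> in M. \<forall>j\<le>k. X j \<omega> = x j) > 0 \<longrightarrow>
        \<P>(\<omega> in M. X (Suc k) \<omega> = m \<bar> \<forall>j\<le>k. X j \<omega> = x j) = pmf (\<kappa> (x k)) m)"

definition indep_processes ::
  "'a measure \<Rightarrow> (nat \<Rightarrow> 'a \<Rightarrow> nat) \<Rightarrow> (nat \<Rightarrow> 'a \<Rightarrow> nat) \<Rightarrow> bool" where
  "indep_processes M X Y \<longleftrightarrow>
     prob_space.indep_var M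
       (\<Pi>\<^sub>M k\<in>UNIV. count_space UNIV) (\<lambda>\<omega> k. X k \<omega>)
       (\<Pi>\<^sub>M k\<in>UNIV. count_space UNIV) (\<lambda>\<omega> k. Y k \<omega>)"


text \<open>The library's \<open>weak_conv_m\<close> is for laws on the real line only.\<close>

definition weak_conv_on ::
  "'a topology \<Rightarrow> (nat \<Rightarrow> 'a measure) \<Rightarrow> 'a measure \<Rightarrow> bool" where
  "weak_conv_on T \<mu> \<nu> \<longleftrightarrow>
     (\<forall>f :: 'a \<Rightarrow> real. continuous_map T euclideanreal f \<and> bounded (f ` topspace T) \<longrightarrow>
        (\<lambda>n. \<integral>x. f x \<partial>\<mu> n) \<longlonglongrightarrow> (\<integral>x. f x \<partial>\<nu>))"

text \<open>The joint law of \<open>(X\<^sub>t)\<close> and \<open>(Y\<^sub>u)\<close>, for \<open>t\<close> and \<open>u\<close> running through the finite lists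
  of times \<open>ts\<close> and \<open>us\<close>.\<close>

definition fin_dim_law ::
  "'a measure \<Rightarrow> (nat \<Rightarrow> 'a \<Rightarrow> nat) \<Rightarrow> (nat \<Rightarrow> 'a \<Rightarrow> nat) \<Rightarrow> nat list \<Rightarrow> nat list
     \<Rightarrow> (nat list \<times> nat list) measure" where
  "fin_dim_law M X Y ts us =
     distr M (count_space UNIV) (\<lambda>\<omega>. (map (\<lambda>t. X t \<omega>) ts, map (\<lambda>u. Y u \<omega>) us))"

definition fin_dim_converges ::
  "(nat \<Rightarrow> 'b measure) \<Rightarrow> (nat \<Rightarrow> nat \<Rightarrow> 'b \<Rightarrow> nat) \<Rightarrow> (nat \<Rightarrow> nat \<Rightarrow> 'b \<Rightarrow> nat)
     \<Rightarrow> 'a measure \<Rightarrow> (nat \<Rightarrow> 'a \<Rightarrow> nat) \<Rightarrow> (nat \<Rightarrow> 'a \<Rightarrow> nat) \<Rightarrow> bool" where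
  "fin_dim_converges N U V M X Y \<longleftrightarrow>
     (\<forall>ts us. weak_conv_on (discrete_topology UNIV)
        (\<lambda>L. fin_dim_law (N L) (U L) (V L) ts us) (fin_dim_law M X Y ts us))"

end

theory Submission
  imports Defs
begin

text \<open>
  Let \<open>A\<close> be the symmetric transfer operator of the path weights. Since
  \<open>(1 - q\<^sup>n\<^sup>+\<^sup>1) (s\<^sub>n\<^sub>+\<^sub>1 + 2 \<sigma> s\<^sub>n + s\<^sub>n\<^sub>-\<^sub>1) = 2 (1 + \<sigma>) s\<^sub>n\<close>, the positive sequence \<open>s\<close> is
  a generalized eigenvector of \<open>A\<close> for \<open>lam = 2 (1 + \<sigma>) / (1 - q)\<close>, which bounds the quadratic
  form of \<open>A\<close> from above by \<open>lam\<close> and from below by \<open>4 \<sigma> - lam\<close>. As \<open>s\<close> grows subexponentially, the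
  weights \<open>g L\<close> of the paths from 0 to 0 then satisfy \<open>g (L + 1) / g L \<longlonglongrightarrow> lam\<close>, and the three-term
  recurrence turns this into \<open>G L m n / g L \<longlonglongrightarrow> s\<^sub>m s\<^sub>n\<close> for the paths from \<open>m\<close> to \<open>n\<close>. Uniform
  domination of these ratios gives the asymptotics of the normalizing constant, so the joint law of
  an initial and a final segment of the path factorizes in the limit, and each factor is the law of
  the chain obtained from \<open>A\<close> by the Doob transform with \<open>s\<close>.
\<close>

section \<open>The q-binomial theorem and the sequence s\<close>

text \<open>Since \<open>s \<ge> 1\<close>, the vector \<open>s\<close> is not square summable for
  the weights \<open>1 / w\<close>, so there is no eigenfunction to project on and the limit has to
  be obtained as a ratio limit. All form estimates are made on finitely supported vectors, where
  they are finite combinations of the numbers \<open>g L\<close>. The strict inequality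
  \<open>4 * \<sigma> - lam > - lam\<close> rules out an oscillation with the parity of the length:
  without horizontal steps \<open>g\<close> would vanish at odd lengths. The q-Pochhammer formula
  enters through the generating function of \<open>s\<close>, a product of two q-binomial series; it
  yields the recurrence, the normalizing constants and, by converging on the whole open unit disc,
  the subexponential growth. Pointwise ratio limits do not survive summation over infinitely many
  end heights; for this the ratios are bounded by a multiple of
  \<open>1 / (\<tau> ^ m * \<tau> ^ n)\<close>, with \<open>\<tau> < 1\<close> as close to 1 as
  needed.\<close>

lemma qpoch_Suc: "qpoch a q (Suc n) = qpoch a q n * (1 - a * complex_of_real q ^ n)"
  by (simp add: qpoch_def)

lemma one_minus_mult_power_nonzero:
  assumes "0 \<le> q" "q < 1" "norm z < 1"
  shows "1 - z * complex_of_real q ^ n \<noteq> 0"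
proof
  assume "1 - z * complex_of_real q ^ n = 0"
  then have "norm (z * complex_of_real q ^ n) = 1" by simp
  moreover have "norm z * q ^ n \<le> norm z * 1"
    using assms by (intro mult_left_mono power_le_one) auto
  ultimately show False
    using assms by (simp add: norm_mult norm_power)
qed

definition qcoeff :: "complex \<Rightarrow> real \<Rightarrow> nat \<Rightarrow> complex" where
  "qcoeff a q k = qpoch a q k / qpoch (complex_of_real q) q k"

lemma qcoeff_0: "qcoeff a q 0 = 1"
  by (simp add: qcoeff_def qpoch_def)

lemma qcoeff_Suc:
  assumes "0 \<le> q" "q < 1"
  shows "qcoeff a q (Suc k) * (1 - complex_of_real q ^ Suc k)
    = qcoeff a q k * (1 - a * complex_of_real q ^ k)"
  using one_minus_mult_power_nonzero[OF assms, of "complex_of_real q" k] assms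
  by (simp add: qcoeff_def qpoch_Suc)

lemma summable_qcoeff:
  assumes q: "0 \<le> q" "q < 1" and z: "norm z < 1"
  shows "summable (\<lambda>k. norm (qcoeff a q k * z ^ k))"
proof -
  have pow: "(\<lambda>k. complex_of_real q ^ k) \<longlonglongrightarrow> 0"
    using q by (intro LIMSEQ_power_zero) auto
  have nz: "1 - complex_of_real q ^ Suc k \<noteq> 0" for k
    using one_minus_mult_power_nonzero[OF q, of "complex_of_real q" k] q by simp
  have "(\<lambda>k. norm (z * (1 - a * complex_of_real q ^ k) / (1 - complex_of_real q ^ Suc k)))
      \<longlonglongrightarrow> norm (z * (1 - a * 0) / (1 - 0))"
    by (intro tendsto_intros pow LIMSEQ_Suc[OF pow]) auto
  \<comment> \<open>The ratio of consecutive terms tends to \<open>norm z\<close>; the ratio test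
    uses the midpoint between \<open>norm z\<close> and 1.\<close>
  then have "eventually (\<lambda>k. norm (z * (1 - a * complex_of_real q ^ k) / (1 - complex_of_real q ^ Suc k))
      < (1 + norm z) / 2) sequentially"
    using z by (intro order_tendstoD) auto
  then obtain K where K: "\<And>k. k \<ge> K \<Longrightarrow>
      norm (z * (1 - a * complex_of_real q ^ k) / (1 - complex_of_real q ^ Suc k)) < (1 + norm z) / 2"
    by (auto simp: eventually_sequentially)
  show ?thesis
  proof (rule summable_ratio_test[of "(1 + norm z) / 2" K])
    fix k assume "K \<le> k"
    have "qcoeff a q (Suc k) * z ^ Suc k = (qcoeff a q k * z ^ k) *
        (z * (1 - a * complex_of_real q ^ k) / (1 - complex_of_real q ^ Suc k))"
    proof -
      have "qcoeff a q (Suc k) = qcoeff a q k * (1 - a * complex_of_real q ^ k) / (1 - complex_of_real q ^ Suc k)"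
        using qcoeff_Suc[OF q, of a k] nz[of k] by (simp add: nonzero_eq_divide_eq del: power_Suc)
      then show ?thesis by (simp only: power_Suc times_divide_eq_right times_divide_eq_left mult_ac)
    qed
    then have "norm (qcoeff a q (Suc k) * z ^ Suc k) = norm (qcoeff a q k * z ^ k) *
        norm (z * (1 - a * complex_of_real q ^ k) / (1 - complex_of_real q ^ Suc k))"
      by (simp only: norm_mult)
    also have "\<dots> \<le> norm (qcoeff a q k * z ^ k) * ((1 + norm z) / 2)"
      using K[OF \<open>K \<le> k\<close>] by (intro mult_left_mono) auto
    finally show "norm (norm (qcoeff a q (Suc k) * z ^ Suc k))
        \<le> (1 + norm z) / 2 * norm (norm (qcoeff a q k * z ^ k))"
      by (simp only: mult.commute real_norm_def abs_norm_cancel)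
  qed (use z in auto)
qed

lemma qpoch_tendsto_qpoch_inf:
  assumes q: "0 \<le> q" "q < 1" and z: "norm z < 1"
  shows "(\<lambda>n. qpoch z q n) \<longlonglongrightarrow> qpoch_inf z q" "qpoch_inf z q \<noteq> 0"
proof -
  have "summable (\<lambda>k. norm (- z * complex_of_real q ^ k))"
    using q by (auto simp: norm_mult norm_power intro!: summable_mult summable_geometric)
  moreover have "- z * complex_of_real q ^ k \<noteq> - 1" for k
    using one_minus_mult_power_nonzero[OF q z, of k] by auto
  ultimately have "convergent_prod (\<lambda>k. 1 + (- z * complex_of_real q ^ k))"
    by (rule summable_imp_convergent_prod_complex)
  then have conv: "convergent_prod (\<lambda>k. 1 - z * complex_of_real q ^ k)"
    by simp
  show "qpoch_inf z q \<noteq> 0"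
    unfolding qpoch_inf_def using conv one_minus_mult_power_nonzero[OF q z] by (rule prodinf_nonzero)
  have "(\<lambda>n. qpoch z q (Suc n)) \<longlonglongrightarrow> qpoch_inf z q"
    using convergent_prod_LIMSEQ[OF conv]
    by (simp add: qpoch_def qpoch_inf_def lessThan_Suc_atMost)
  then show "(\<lambda>n. qpoch z q n) \<longlonglongrightarrow> qpoch_inf z q"
    by (rule LIMSEQ_imp_Suc)
qed

text \<open>The functional equation \<open>(1 - z) f(z) = (1 - a z) f(q z)\<close>, iterated along \<open>q\<^sup>n z\<close>.\<close>

lemma q_binomial:
  assumes q: "0 \<le> q" "q < 1" and z: "norm z < 1" and a: "norm a \<le> 1"
  shows "(\<lambda>k. qcoeff a q k * z ^ k) sums (qpoch_inf (a * z) q / qpoch_inf z q)"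
proof -
  define f where "f z = (\<Sum>k. qcoeff a q k * z ^ k)" for z
  have f: "(\<lambda>k. qcoeff a q k * y ^ k) sums f y" if "norm y < 1" for y
    unfolding f_def using summable_qcoeff[OF q that] by (intro summable_sums) (rule summable_norm_cancel)
  have le: "norm (a * z) \<le> norm z"
    using a mult_right_mono[of "norm a" 1 "norm z"] by (simp add: norm_mult)
  have qz: "norm (complex_of_real q ^ n * z) < 1" for n
  proof -
    have "q ^ n * norm z \<le> 1 * norm z" using q by (intro mult_right_mono power_le_one) auto
    then show ?thesis using z q by (simp add: norm_mult norm_power)
  qed
  have feq: "(1 - y) * f y = (1 - a * y) * f (of_real q * y)" if y: "norm y < 1" for y
  proof -
    have y': "norm (of_real q * y) < 1"
      using mult_right_mono[of q 1 "norm y"] q y by (simp add: norm_mult)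
    have S1: "(\<lambda>k. (qcoeff a q k - of_real q ^ k * qcoeff a q k) * y ^ k) sums (f y - f (of_real q * y))"
      using sums_diff[OF f[OF y] f[OF y']] by (simp add: power_mult_distrib algebra_simps)
    have S2: "(\<lambda>k. y * (qcoeff a q k * y ^ k) - a * y * (qcoeff a q k * (of_real q * y) ^ k))
        sums (y * f y - a * y * f (of_real q * y))"
      by (intro sums_diff sums_mult f y y')
    have "(\<lambda>k. (qcoeff a q (Suc k) - of_real q ^ Suc k * qcoeff a q (Suc k)) * y ^ Suc k)
        = (\<lambda>k. y * (qcoeff a q k * y ^ k) - a * y * (qcoeff a q k * (of_real q * y) ^ k))"
    proof
      fix k
      have "(qcoeff a q (Suc k) - of_real q ^ Suc k * qcoeff a q (Suc k)) * y ^ Suc k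
        = (qcoeff a q (Suc k) * (1 - of_real q ^ Suc k)) * y ^ Suc k"
        by (simp add: algebra_simps)
      also have "\<dots> = qcoeff a q k * (1 - a * of_real q ^ k) * y ^ Suc k"
        using qcoeff_Suc[OF q] by simp
      finally show "(qcoeff a q (Suc k) - of_real q ^ Suc k * qcoeff a q (Suc k)) * y ^ Suc k
        = y * (qcoeff a q k * y ^ k) - a * y * (qcoeff a q k * (of_real q * y) ^ k)"
        by (simp add: algebra_simps power_mult_distrib)
    qed
    then have "(\<lambda>k. (qcoeff a q (Suc k) - of_real q ^ Suc k * qcoeff a q (Suc k)) * y ^ Suc k)
        sums (y * f y - a * y * f (of_real q * y))"
      using S2 by simp
    \<comment> \<open>Restoring the term of index 0 leaves the sum unchanged, as its factor
      \<open>1 - q ^ 0\<close> is zero.\<close>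
    then have "(\<lambda>k. (qcoeff a q k - of_real q ^ k * qcoeff a q k) * y ^ k)
        sums (y * f y - a * y * f (of_real q * y))"
      by (subst (asm) sums_Suc_iff) simp
    then have "f y - f (of_real q * y) = y * f y - a * y * f (of_real q * y)"
      using S1 sums_unique2 by blast
    then show ?thesis by (simp add: algebra_simps)
  qed
  have iter: "qpoch z q n * f z = qpoch (a * z) q n * f (of_real q ^ n * z)" for n
  proof (induction n)
    case (Suc n)
    have "qpoch z q (Suc n) * f z = (1 - of_real q ^ n * z) * (qpoch z q n * f z)"
      by (simp add: qpoch_Suc algebra_simps)
    also have "\<dots> = qpoch (a * z) q n * ((1 - of_real q ^ n * z) * f (of_real q ^ n * z))"
      using Suc by (simp add: algebra_simps)
    also have "\<dots> = qpoch (a * z) q (Suc n) * f (of_real q ^ Suc n * z)"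
      by (subst feq[OF qz]) (simp add: qpoch_Suc algebra_simps)
    finally show ?case .
  qed (simp add: qpoch_def)
  \<comment> \<open>Convergence at a single nonzero point, here 1/2, already gives continuity at
    0.\<close>
  have "summable (\<lambda>n. qcoeff a q n * (1 / 2) ^ n)"
    using summable_qcoeff[OF q, of "1/2" a] by (rule summable_norm_cancel[of "\<lambda>n. qcoeff a q n * (1 / 2) ^ n"]) simp
  then have cont: "isCont f 0"
    unfolding f_def[abs_def] by (rule isCont_powser) simp
  have "(\<lambda>n. complex_of_real q ^ n * z) \<longlonglongrightarrow> 0 * z"
    using q by (intro tendsto_intros LIMSEQ_power_zero) auto
  then have "(\<lambda>n. f (of_real q ^ n * z)) \<longlonglongrightarrow> f 0"
    using isCont_tendsto_compose[OF cont] by simp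
  moreover have "f 0 = 1"
    unfolding f_def by (simp add: qcoeff_0 powser_zero)
  ultimately have "(\<lambda>n. qpoch (a * z) q n * f (of_real q ^ n * z)) \<longlonglongrightarrow> qpoch_inf (a * z) q * 1"
    using qpoch_tendsto_qpoch_inf[OF q, of "a * z"] le z by (intro tendsto_mult) auto
  moreover have "(\<lambda>n. qpoch z q n * f z) \<longlonglongrightarrow> qpoch_inf z q * f z"
    using qpoch_tendsto_qpoch_inf[OF q z] by (intro tendsto_intros) auto
  ultimately have "qpoch_inf z q * f z = qpoch_inf (a * z) q"
    unfolding iter by (simp add: LIMSEQ_unique)
  then have "f z = qpoch_inf (a * z) q / qpoch_inf z q"
    using qpoch_tendsto_qpoch_inf(2)[OF q z] by (simp add: field_simps)
  then show ?thesis using f[OF z] by simp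
qed

section \<open>Formal power series and the recurrence of \<open>s\<close>\<close>

definition fps_dilate :: "'a::comm_ring_1 \<Rightarrow> 'a fps \<Rightarrow> 'a fps" where
  "fps_dilate c f = Abs_fps (\<lambda>n. c ^ n * fps_nth f n)"

lemma fps_dilate_mult: "fps_dilate c (f * g) = fps_dilate c f * fps_dilate c g"
proof (rule fps_ext)
  fix n
  have "c ^ n * (\<Sum>i=0..n. fps_nth f i * fps_nth g (n - i)) = (\<Sum>i=0..n. c ^ i * fps_nth f i * (c ^ (n - i) * fps_nth g (n - i)))"
    unfolding sum_distrib_left
  proof (rule sum.cong)
    fix i assume "i \<in> {0..n}"
    then have "c ^ n = c ^ i * c ^ (n - i)"
      by (simp flip: power_add)
    then show "c ^ n * (fps_nth f i * fps_nth g (n - i)) = c ^ i * fps_nth f i * (c ^ (n - i) * fps_nth g (n - i))"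
      by (simp add: algebra_simps)
  qed simp
  then show "fps_nth (fps_dilate c (f * g)) n = fps_nth (fps_dilate c f * fps_dilate c g) n"
    by (simp add: fps_dilate_def fps_mult_nth)
qed

text \<open>Coefficient by coefficient this is \<open>qcoeff_Suc\<close>. It is the functional
  equation of the q-binomial series in formal guise, so the recurrence of the product of two such
  series needs no convergence.\<close>

lemma fps_dilate_qcoeff:
  assumes "0 \<le> q" "q < 1"
  shows "(1 - fps_X) * Abs_fps (qcoeff a q) =
    (1 - fps_const a * fps_X) * fps_dilate (complex_of_real q) (Abs_fps (qcoeff a q))"
proof (rule fps_ext)
  fix n
  show "fps_nth ((1 - fps_X) * Abs_fps (qcoeff a q)) n =
    fps_nth ((1 - fps_const a * fps_X) * fps_dilate (complex_of_real q) (Abs_fps (qcoeff a q))) n"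
  proof (cases n)
    case (Suc k)
    then show ?thesis
      using qcoeff_Suc[OF assms, of a k]
      by (simp add: algebra_simps fps_dilate_def)
  qed (simp add: algebra_simps fps_dilate_def)
qed

text \<open>Coefficient extraction from \<open>(1 - x)\<^sup>2 S(x) = (1 - a x) (1 - b x) S(q x)\<close>, where
  \<open>a + b = - 2 q \<sigma>\<close> and \<open>a b = q\<^sup>2\<close>.\<close>

lemma s_seq_recurrence:
  assumes q: "0 \<le> q" "q < 1" and \<sigma>: "0 < \<sigma>" "\<sigma> \<le> 1"
  shows "complex_of_real (1 - q ^ Suc n) *
      (s_seq \<sigma> q (int n + 1) + 2 * complex_of_real \<sigma> * s_seq \<sigma> q (int n) + s_seq \<sigma> q (int n - 1))
    = 2 * (1 + complex_of_real \<sigma>) * s_seq \<sigma> q (int n)"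
proof -
  define a b where "a = param_a \<sigma> q" and "b = param_b \<sigma> q"
  define r where "r = complex_of_real (sqrt (1 - \<sigma>\<^sup>2))"
  define Q where "Q = complex_of_real q"
  define T where "T = complex_of_real \<sigma>"
  have r2: "r * r = 1 - T * T"
    using \<sigma> by (simp add: r_def T_def power2_eq_square mult_le_one flip: of_real_mult)
  have ea: "a = - Q * (T + \<i> * r)" and eb: "b = - Q * (T - \<i> * r)"
    by (simp_all add: a_def b_def param_a_def param_b_def r_def Q_def T_def)
  have "(T + \<i> * r) * (T - \<i> * r) = T * T + r * r"
    by (simp add: algebra_simps)
  moreover have "a * b = Q * Q * ((T + \<i> * r) * (T - \<i> * r))"
    unfolding ea eb by (simp only: mult_ac minus_mult_left[symmetric] mult_minus_right minus_minus)
  ultimately have ab: "a + b = - 2 * Q * T" "a * b = Q\<^sup>2"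
    using r2 by (simp_all add: ea eb power2_eq_square distrib_left right_diff_distrib)
  define S where "S = Abs_fps (qcoeff a q) * Abs_fps (qcoeff b q)"
  have S: "s_seq \<sigma> q (int n) = fps_nth S n" for n
    by (simp add: s_seq_def S_def fps_mult_nth qcoeff_def a_def b_def)
  have "(1 - fps_X) * (1 - fps_X) * S =
      ((1 - fps_X) * Abs_fps (qcoeff a q)) * ((1 - fps_X) * Abs_fps (qcoeff b q))"
    by (simp add: S_def algebra_simps)
  also have "\<dots> = (1 - fps_const a * fps_X) * ((1 - fps_const b * fps_X) * fps_dilate Q S)"
    unfolding fps_dilate_qcoeff[OF q] S_def fps_dilate_mult Q_def by (simp only: mult_ac)
  \<comment> \<open>The factor \<open>1 - fps_X\<close> is written with \<open>fps_const 1\<close>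
    so that the one formula \<open>coeff\<close> serves both sides, with \<open>c = d = 1\<close> on
    the left and with \<open>a\<close>, \<open>b\<close> on the right.\<close>
  finally have eq: "(1 - fps_const 1 * fps_X) * ((1 - fps_const 1 * fps_X) * S) =
     (1 - fps_const a * fps_X) * ((1 - fps_const b * fps_X) * fps_dilate Q S)"
    by (simp add: mult.assoc)
  have coeff1: "fps_nth ((1 - fps_const c * fps_X) * F) m = fps_nth F m - c * (if m = 0 then 0 else fps_nth F (m - 1))"
    for c and F :: "complex fps" and m
    by (cases m) (simp_all add: left_diff_distrib mult.assoc)
  have coeff: "fps_nth ((1 - fps_const c * fps_X) * ((1 - fps_const d * fps_X) * F)) (Suc n)
      = fps_nth F (Suc n) - (c + d) * fps_nth F n + (c * d) * (if n = 0 then 0 else fps_nth F (n - 1))"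
    for c d and F :: "complex fps"
    unfolding coeff1 by (simp add: algebra_simps)
  \<comment> \<open>The coefficient missing at \<open>n = 0\<close> is the value 0 that
    \<open>s_seq\<close> has at index -1.\<close>
  have pm: "(if n = 0 then 0 else fps_nth S (n - 1)) = s_seq \<sigma> q (int n - 1)"
    by (cases n) (auto simp: s_seq_def S[unfolded s_seq_def] simp flip: S)
  have "fps_nth S (Suc n) - 2 * fps_nth S n + (if n = 0 then 0 else fps_nth S (n - 1)) =
      Q ^ Suc n * (fps_nth S (Suc n) + 2 * T * fps_nth S n + (if n = 0 then 0 else fps_nth S (n - 1)))"
    using arg_cong[OF eq, of "\<lambda>F. fps_nth F (Suc n)"] unfolding coeff ab
    by (cases n) (simp_all add: fps_dilate_def algebra_simps power2_eq_square)
  then show ?thesis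
    using S[of "Suc n"] S[of n] unfolding pm
    by (simp add: Q_def T_def algebra_simps add.commute[of _ 1])
qed

lemma s_seq_0: "s_seq \<sigma> q 0 = 1"
  by (simp add: s_seq_def qpoch_def)

text \<open>The generating function of \<open>s_seq\<close> is the Cauchy product of two q-binomial
  series. The theorem applies to both because \<open>a\<close> and \<open>b\<close> are
  \<open>- q\<close> times points of the unit circle; their modulus \<open>q < 1\<close> also keeps
  the infinite products from vanishing.\<close>

lemma s_seq_sums_init_const:
  assumes q: "0 \<le> q" "q < 1" and \<sigma>: "0 < \<sigma>" "\<sigma> \<le> 1" and \<rho>: "0 \<le> \<rho>" "\<rho> < 1"
  shows "(\<lambda>n. complex_of_real \<rho> ^ n * s_seq \<sigma> q (int n)) sums init_const \<sigma> q \<rho>"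
    and "init_const \<sigma> q \<rho> \<noteq> 0"
proof -
  define a b where "a = param_a \<sigma> q" and "b = param_b \<sigma> q"
  define z where "z = complex_of_real \<rho>"
  have nz: "norm z < 1" using \<rho> by (simp add: z_def)
  have u: "norm (complex_of_real \<sigma> + \<i> * complex_of_real (sqrt (1 - \<sigma>\<^sup>2))) = 1"
    "norm (complex_of_real \<sigma> - \<i> * complex_of_real (sqrt (1 - \<sigma>\<^sup>2))) = 1"
    using \<sigma> by (auto simp: cmod_def abs_square_le_1)
  have ab: "norm a = q" "norm b = q"
    using q by (auto simp only: a_def b_def param_a_def param_b_def norm_mult norm_minus_cancel u norm_of_real)
  have na: "norm (a * z) < 1" "norm (b * z) < 1"
    using mult_right_mono[of q 1 "norm z"] q nz by (auto simp: norm_mult ab)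
  have A: "(\<lambda>k. qcoeff a q k * z ^ k) sums (qpoch_inf (a * z) q / qpoch_inf z q)"
    and B: "(\<lambda>k. qcoeff b q k * z ^ k) sums (qpoch_inf (b * z) q / qpoch_inf z q)"
    using q ab nz by (auto intro!: q_binomial)
  have "(\<lambda>n. \<Sum>i\<le>n. (qcoeff a q i * z ^ i) * (qcoeff b q (n - i) * z ^ (n - i)))
      sums ((\<Sum>k. qcoeff a q k * z ^ k) * (\<Sum>k. qcoeff b q k * z ^ k))"
    by (intro Cauchy_product_sums summable_qcoeff q nz)
  moreover have "(\<Sum>i\<le>n. (qcoeff a q i * z ^ i) * (qcoeff b q (n - i) * z ^ (n - i)))
      = z ^ n * s_seq \<sigma> q (int n)" for n
  proof -
    have "(\<Sum>i\<le>n. (qcoeff a q i * z ^ i) * (qcoeff b q (n - i) * z ^ (n - i))) =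
       (\<Sum>i\<le>n. z ^ n * (qcoeff a q i * qcoeff b q (n - i)))"
    proof (rule sum.cong)
      fix i assume "i \<in> {..n}"
      then have "z ^ n = z ^ i * z ^ (n - i)" by (simp flip: power_add)
      then show "(qcoeff a q i * z ^ i) * (qcoeff b q (n - i) * z ^ (n - i)) = z ^ n * (qcoeff a q i * qcoeff b q (n - i))"
        by (simp add: algebra_simps)
    qed simp
    also have "\<dots> = z ^ n * s_seq \<sigma> q (int n)"
      by (simp add: s_seq_def qcoeff_def a_def b_def atMost_atLeast0 sum_distrib_left)
    finally show ?thesis .
  qed
  ultimately show "(\<lambda>n. complex_of_real \<rho> ^ n * s_seq \<sigma> q (int n)) sums init_const \<sigma> q \<rho>"
    unfolding sums_unique[OF A, symmetric] sums_unique[OF B, symmetric]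
    by (simp add: init_const_def a_def b_def z_def power2_eq_square)
  show "init_const \<sigma> q \<rho> \<noteq> 0"
    using qpoch_tendsto_qpoch_inf(2)[OF q nz] qpoch_tendsto_qpoch_inf(2)[OF q na(1)]
      qpoch_tendsto_qpoch_inf(2)[OF q na(2)]
    by (simp add: init_const_def a_def b_def z_def)
qed

section \<open>The transfer operator\<close>

locale motzkin_params =
  fixes \<sigma> q :: real
  assumes q: "0 \<le> q" "q < 1" and \<sigma>: "0 < \<sigma>" "\<sigma> \<le> 1"
begin

definition w :: "nat \<Rightarrow> real" where
  "w n = q_number q (n + 1)"

text \<open>The growth rate at large heights: \<open>w\<close> tends to \<open>1 / (1 - q)\<close>,
  and away from height 0 \<open>hop\<close> multiplies constants by
  \<open>2 + 2 * \<sigma>\<close>.\<close>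

definition lam :: real where
  "lam = 2 * (1 + \<sigma>) / (1 - q)"

definition hop :: "(nat \<Rightarrow> real) \<Rightarrow> nat \<Rightarrow> real" where
  "hop f m = f (Suc m) + 2 * \<sigma> * f m + (if m = 0 then 0 else f (m - 1))"

lemma w_eq: "w n = (1 - q ^ Suc n) / (1 - q)"
  using q by (simp only: w_def q_number_def Suc_eq_plus1[symmetric] sum_gp_strict) simp

lemma w_ge_1: "1 \<le> w n"
  using q_number_bounds(1)[OF q, of "n + 1"] by (simp add: w_def)

lemma w_pos: "0 < w n"
  using w_ge_1[of n] by simp

lemma w_0: "w 0 = 1"
  by (simp add: w_def q_number_def)

lemma w_mono: "w m \<le> w (Suc m)"
  using q by (simp add: w_def q_number_def)

lemma w_tendsto: "w \<longlonglongrightarrow> 1 / (1 - q)"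
proof -
  have "(\<lambda>n. (1 - q ^ Suc n) / (1 - q)) \<longlonglongrightarrow> (1 - 0) / (1 - q)"
    using q by (intro tendsto_intros LIMSEQ_Suc[OF LIMSEQ_power_zero]) auto
  then show ?thesis by (simp add: w_eq[abs_def])
qed

lemma w_le: "w n \<le> 1 / (1 - q)"
  using q by (simp add: w_eq divide_right_mono del: power_Suc)

lemma lam_ge: "2 * (1 + \<sigma>) \<le> lam"
  using q \<sigma> mult_left_mono[of "1 - q" 1 "2 * (1 + \<sigma>)"] by (simp add: lam_def le_divide_eq)

lemma lam_pos: "0 < lam"
  using q \<sigma> by (simp add: lam_def)

text \<open>Reality and positivity are hard to see in the complex formula, so the sequence is
  defined anew by its recurrence; \<open>s_seq_eq\<close> identifies the two.\<close>

fun s :: "nat \<Rightarrow> real" where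
  "s 0 = 1"
| "s (Suc 0) = lam / w 0 - 2 * \<sigma>"
| "s (Suc (Suc m)) = (lam / w (Suc m) - 2 * \<sigma>) * s (Suc m) - s m"

lemma hop_s: "hop s m = lam / w m * s m"
  by (cases m) (auto simp: hop_def algebra_simps)

lemma s_Suc: "s (Suc m) = lam / w m * s m - 2 * \<sigma> * s m - (if m = 0 then 0 else s (m - 1))"
  using hop_s[of m] by (auto simp: hop_def split: if_splits)

lemma lam_div_w_ge: "2 * (1 + \<sigma>) \<le> lam / w m"
proof -
  have "2 * (1 + \<sigma>) * w m \<le> 2 * (1 + \<sigma>) * (1 / (1 - q))"
    using w_le \<sigma> by (intro mult_left_mono) auto
  then show ?thesis
    unfolding lam_def using w_pos[of m] by (subst pos_le_divide_eq) auto
qed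

text \<open>As \<open>lam / w m - 2 * \<sigma>\<close> is at least 2, the recurrence makes the
  increments of \<open>s\<close> nondecreasing, and the first one is positive.\<close>

lemma s_increasing: "1 \<le> s m \<and> s m \<le> s (Suc m)"
proof (induction m)
  case 0
  show ?case using lam_div_w_ge[of 0] by simp
next
  case (Suc m)
  have "2 * s (Suc m) \<le> (lam / w (Suc m) - 2 * \<sigma>) * s (Suc m)"
    using lam_div_w_ge[of "Suc m"] Suc by (intro mult_right_mono) auto
  then have "s (Suc m) \<le> (lam / w (Suc m) - 2 * \<sigma>) * s (Suc m) - s m"
    using Suc by linarith
  then show ?case using Suc by simp
qed

lemma s_ge_1: "1 \<le> s m" and s_pos: "0 < s m"
  using s_increasing[of m] by auto

lemma s_seq_eq: "s_seq \<sigma> q (int n) = complex_of_real (s n)"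
proof -
  have rec: "s_seq \<sigma> q (int n + 1) = complex_of_real (lam / w n - 2 * \<sigma>) * s_seq \<sigma> q (int n) - s_seq \<sigma> q (int n - 1)" for n
  proof -
    define Q where "Q = 1 - q ^ Suc n"
    have Q: "Q \<noteq> 0" using w_pos[of n] w_eq[of n] by (auto simp: Q_def simp del: power_Suc)
    have lw: "lam / w n = 2 * (1 + \<sigma>) / Q"
      using q by (simp add: lam_def w_eq Q_def[symmetric] del: power_Suc)
    have "complex_of_real Q * (s_seq \<sigma> q (int n + 1) + 2 * complex_of_real \<sigma> * s_seq \<sigma> q (int n)
        + s_seq \<sigma> q (int n - 1)) = 2 * (1 + complex_of_real \<sigma>) * s_seq \<sigma> q (int n)"
      unfolding Q_def by (rule s_seq_recurrence[OF q \<sigma>])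
    then show ?thesis
      unfolding lw using Q by (simp add: field_simps)
  qed
  show ?thesis
  proof (induction n rule: s.induct)
    case 2
    show ?case using rec[of 0] by (simp add: s_seq_0) (simp add: s_seq_def)
  next
    case (3 m)
    show ?case using rec[of "Suc m"] 3 by (simp add: add.commute)
  qed (simp add: s_seq_0)
qed

declare s.simps [simp del]

lemma init_const_real:
  assumes "0 \<le> \<rho>" "\<rho> < 1"
  shows "(\<lambda>n. \<rho> ^ n * s n) sums Re (init_const \<sigma> q \<rho>)"
    and "init_const \<sigma> q \<rho> = complex_of_real (Re (init_const \<sigma> q \<rho>))"
    and "0 < Re (init_const \<sigma> q \<rho>)"
proof -
  have S: "(\<lambda>n. complex_of_real (\<rho> ^ n * s n)) sums init_const \<sigma> q \<rho>"
    using s_seq_sums_init_const(1)[OF q \<sigma> assms] by (simp add: s_seq_eq)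
  show R: "(\<lambda>n. \<rho> ^ n * s n) sums Re (init_const \<sigma> q \<rho>)"
    using sums_Re[OF S] by simp
  show eq: "init_const \<sigma> q \<rho> = complex_of_real (Re (init_const \<sigma> q \<rho>))"
    using sums_unique2[OF S sums_of_real[OF R, where 'a = complex]] by simp
  have nn: "0 \<le> \<rho> ^ n * s n" for n
    using assms s_pos[of n] by simp
  have "0 \<le> Re (init_const \<sigma> q \<rho>)"
    using sums_le[OF _ sums_zero R] nn by auto
  moreover have "Re (init_const \<sigma> q \<rho>) \<noteq> 0"
    using s_seq_sums_init_const(2)[OF q \<sigma> assms] eq by auto
  ultimately show "0 < Re (init_const \<sigma> q \<rho>)" by simp
qed

text \<open>The generating function converges at every \<tau> below 1, so its terms are
  bounded.\<close>

lemma s_subexponential: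
  assumes "0 < \<tau>" "\<tau> < 1"
  obtains C where "0 < C" "\<And>m. s m * \<tau> ^ m \<le> C"
proof -
  have "(\<lambda>n. \<tau> ^ n * s n) \<longlonglongrightarrow> 0"
    using init_const_real(1)[of \<tau>] assms by (intro summable_LIMSEQ_zero) (auto simp: sums_iff)
  then obtain C where "0 < C" "\<And>n. norm (\<tau> ^ n * s n) \<le> C"
    using convergent_imp_Bseq[of "\<lambda>n. \<tau> ^ n * s n"] unfolding Bseq_def convergent_def by blast
  then show ?thesis
    by (intro that[of C]) (auto simp: mult.commute abs_le_iff)
qed

subsection \<open>The path kernel\<close>

text \<open>\<open>G L m n\<close> is the total weight of the paths of length \<open>L\<close> from \<open>m\<close> to \<open>n\<close>, see
  \<open>event_weight_singletons\<close>; the inner product under which the kernel is symmetric has weights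
  \<open>1 / w\<close>.\<close>

fun G :: "nat \<Rightarrow> nat \<Rightarrow> nat \<Rightarrow> real" where
  "G 0 m n = (if m = n then w m else 0)"
| "G (Suc L) m n = w m * hop (\<lambda>k. G L k n) m"

lemma hop_mult: "hop (\<lambda>m. c * f m) m = c * hop f m"
  by (simp add: hop_def algebra_simps)

lemma hop_add: "hop (\<lambda>m. f m + g m) m = hop f m + hop g m"
  by (simp add: hop_def algebra_simps)

lemma hop_commute: "hop (\<lambda>m. hop (F m) n) m = hop (\<lambda>n. hop (\<lambda>m. F m n) m) n"
  by (simp add: hop_def algebra_simps)

text \<open>\<open>G\<close> is defined by adding steps at the left end. Steps added at the two ends
  act on different variables and therefore commute; the symmetry of \<open>G\<close> rests on
  this.\<close>

lemma G_Suc_right: "G (Suc L) m n = w n * hop (G L m) n"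
proof (induction L arbitrary: m n)
  case 0
  show ?case by (auto simp: hop_def)
next
  case (Suc L)
  have "G (Suc (Suc L)) m n = w m * hop (\<lambda>k. w n * hop (G L k) n) m"
    using Suc by (simp only: G.simps)
  also have "\<dots> = w n * hop (\<lambda>j. w m * hop (\<lambda>k. G L k j) m) n"
    using hop_commute[of "G L" n m] by (simp add: hop_mult)
  finally show ?case by simp
qed

lemma G_commute: "G L m n = G L n m"
proof (induction L arbitrary: m n)
  case (Suc L)
  show ?case unfolding G_Suc_right[of L n m] using Suc by (simp add: hop_def)
qed auto

lemma hop_nonneg: "(\<And>k. 0 \<le> f k) \<Longrightarrow> 0 \<le> hop f m"
  using \<sigma> by (simp add: hop_def)

lemma G_nonneg: "0 \<le> G L m n"
proof (induction L arbitrary: m n)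
  case (Suc L)
  then show ?case using w_pos[of m] by (simp add: hop_nonneg)
qed (auto intro: less_imp_le[OF w_pos])

lemma G_eq_0: "m > n + L \<Longrightarrow> G L m n = 0"
  by (induction L arbitrary: m) (auto simp: hop_def)

lemma G_00_pos: "0 < G L 0 0"
proof (induction L)
  case (Suc L)
  then show ?case
    using \<sigma> G_nonneg[of L "Suc 0" 0] by (simp add: hop_def w_0 add_nonneg_pos)
qed (simp add: w_0)

lemma G_00_step: "2 * \<sigma> * G L 0 0 \<le> G (Suc L) 0 0"
  using G_nonneg[of L "Suc 0" 0] by (simp add: hop_def w_0)

text \<open>Summation by parts leaves the boundary term
  \<open>f (Suc B) * h B - f B * h (Suc B)\<close>. Only \<open>f\<close> has to vanish there, so
  \<open>h\<close> may be \<open>s\<close>, which does not decay.\<close>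

lemma sum_hop_commute:
  assumes "f B = 0" "f (Suc B) = 0"
  shows "(\<Sum>m<Suc B. hop f m * h m) = (\<Sum>m<Suc B. f m * hop h m)"
proof -
  have "(\<Sum>m<Suc B. hop f m * h m) - (\<Sum>m<Suc B. f m * hop h m) = f (Suc B) * h B - f B * h (Suc B)"
    by (induction B) (simp_all add: hop_def algebra_simps)
  then show ?thesis using assms by simp
qed

text \<open>Two path segments are glued at height \<open>m\<close>; its weight \<open>w m\<close> is
  contained in both kernels, hence the division. Heights above \<open>B\<close> are out of reach
  from \<open>n\<close> in \<open>L\<close> steps, so the finite sum is complete.\<close>

lemma G_convolution:
  assumes "n + L \<le> B"
  shows "(\<Sum>m\<le>B. G L m n * G K m k / w m) = G (L + K) n k"
  using assms
proof (induction L arbitrary: K)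
  case 0
  have "(\<Sum>m\<le>B. G 0 m n * G K m k / w m) = (\<Sum>m\<in>{n}. G 0 m n * G K m k / w m)"
    using 0 by (intro sum.mono_neutral_right) auto
  then show ?case using w_pos[of n] by simp
next
  case (Suc L)
  have "(\<Sum>m\<le>B. G (Suc L) m n * G K m k / w m) = (\<Sum>m<Suc B. hop (\<lambda>m. G L m n) m * G K m k)"
    using w_pos by (intro sum.cong) (auto simp: less_imp_neq[OF w_pos, symmetric])
  \<comment> \<open>From \<open>n + Suc L \<le> B\<close> it follows that \<open>G L m n\<close> is
    already zero at \<open>m = B\<close>.\<close>
  also have "\<dots> = (\<Sum>m<Suc B. G L m n * hop (\<lambda>m. G K m k) m)"
    using Suc.prems by (intro sum_hop_commute) (auto intro: G_eq_0)
  also have "\<dots> = (\<Sum>m\<le>B. G L m n * G (Suc K) m k / w m)"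
    using w_pos by (intro sum.cong) (auto simp: less_imp_neq[OF w_pos, symmetric])
  also have "\<dots> = G (L + Suc K) n k"
    using Suc by (intro Suc.IH) auto
  finally show ?case by simp
qed

text \<open>The steps are moved one at a time from the kernel onto \<open>s\<close>, each at the
  price of a factor \<open>lam\<close>.\<close>

lemma G_eigen:
  assumes "n + L \<le> B"
  shows "(\<Sum>m\<le>B. G L m n * s m / w m) = lam ^ L * s n"
  using assms
proof (induction L)
  case 0
  have "(\<Sum>m\<le>B. G 0 m n * s m / w m) = (\<Sum>m\<in>{n}. G 0 m n * s m / w m)"
    using 0 by (intro sum.mono_neutral_right) auto
  then show ?case using w_pos[of n] by simp
next
  case (Suc L)
  have "(\<Sum>m\<le>B. G (Suc L) m n * s m / w m) = (\<Sum>m<Suc B. hop (\<lambda>m. G L m n) m * s m)"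
    using w_pos by (intro sum.cong) (auto simp: less_imp_neq[OF w_pos, symmetric])
  also have "\<dots> = (\<Sum>m<Suc B. G L m n * hop s m)"
    using Suc.prems by (intro sum_hop_commute) (auto intro: G_eq_0)
  also have "\<dots> = lam * (\<Sum>m\<le>B. G L m n * s m / w m)"
    unfolding sum_distrib_left by (intro sum.cong) (auto simp: hop_s)
  also have "\<dots> = lam * (lam ^ L * s n)"
    using Suc by simp
  finally show ?case by simp
qed

subsection \<open>Quadratic form bounds\<close>

text \<open>Schur test with the positive eigenvector \<open>s\<close>.\<close>

lemma hop_form_bound:
  assumes f: "f B = 0"
  shows "2 * \<bar>\<Sum>m<B. f m * f (Suc m)\<bar> \<le> (\<Sum>m\<le>B. (lam / w m - 2 * \<sigma>) * (f m)\<^sup>2)"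
proof -
  \<comment> \<open>Weighted AM-GM. The weight \<open>s (Suc m) / s m\<close> is chosen so that the
    two contributions to each \<open>(f m)\<^sup>2\<close> add up to
    \<open>lam / w m - 2 * \<sigma>\<close> by the recurrence.\<close>
  have ptw: "2 * \<bar>f m * f (Suc m)\<bar> \<le> s (Suc m) / s m * (f m)\<^sup>2 + s m / s (Suc m) * (f (Suc m))\<^sup>2" for m
  proof -
    define x where "x = sqrt (s (Suc m) / s m)"
    have x: "0 < x" "x\<^sup>2 = s (Suc m) / s m" "1 / x\<^sup>2 = s m / s (Suc m)"
      using s_pos[of m] s_pos[of "Suc m"] by (auto simp: x_def)
    have "0 \<le> (x * \<bar>f m\<bar> - \<bar>f (Suc m)\<bar> / x)\<^sup>2" by simp
    also have "\<dots> = x\<^sup>2 * (f m)\<^sup>2 + 1 / x\<^sup>2 * (f (Suc m))\<^sup>2 - 2 * \<bar>f m * f (Suc m)\<bar>"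
      using x(1) by (simp add: power2_diff power_mult_distrib power_divide abs_mult)
    finally show ?thesis unfolding x by simp
  qed
  have "2 * \<bar>\<Sum>m<B. f m * f (Suc m)\<bar> \<le> (\<Sum>m<B. 2 * \<bar>f m * f (Suc m)\<bar>)"
    by (simp add: sum_abs flip: sum_distrib_left)
  also have "\<dots> \<le> (\<Sum>m<B. s (Suc m) / s m * (f m)\<^sup>2 + s m / s (Suc m) * (f (Suc m))\<^sup>2)"
    by (intro sum_mono ptw)
  \<comment> \<open>\<open>f B = 0\<close> allows the extra term \<open>m = B\<close> in the first
    sum; the second is shifted by one and gets a zero term at \<open>m = 0\<close>.\<close>
  also have "\<dots> = (\<Sum>m<Suc B. s (Suc m) / s m * (f m)\<^sup>2)
      + (\<Sum>m<Suc B. (if m = 0 then 0 else s (m - 1)) / s m * (f m)\<^sup>2)"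
    using f by (subst (2) sum.lessThan_Suc_shift) (simp add: sum.distrib)
  also have "\<dots> = (\<Sum>m<Suc B. (lam / w m - 2 * \<sigma>) * (f m)\<^sup>2)"
    unfolding sum.distrib[symmetric]
  proof (rule sum.cong)
    fix m
    have "s (Suc m) + (if m = 0 then 0 else s (m - 1)) = (lam / w m - 2 * \<sigma>) * s m"
      using s_Suc[of m] by (simp add: algebra_simps)
    then have "s (Suc m) / s m + (if m = 0 then 0 else s (m - 1)) / s m = lam / w m - 2 * \<sigma>"
      using s_pos[of m] by (simp add: field_simps)
    then show "s (Suc m) / s m * (f m)\<^sup>2 + (if m = 0 then 0 else s (m - 1)) / s m * (f m)\<^sup>2
        = (lam / w m - 2 * \<sigma>) * (f m)\<^sup>2"
      by (metis distrib_right)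
  qed simp
  finally show ?thesis by (simp add: lessThan_Suc_atMost)
qed

lemma hop_form_eq:
  assumes f: "f B = 0"  "f (Suc B) = 0"
  shows "(\<Sum>m\<le>B. hop f m * f m) = 2 * (\<Sum>m<B. f m * f (Suc m)) + (\<Sum>m\<le>B. 2 * \<sigma> * (f m)\<^sup>2)"
proof -
  have "(\<Sum>m\<le>B. hop f m * f m) = 2 * (\<Sum>m<B. f m * f (Suc m)) + (\<Sum>m\<le>B. 2 * \<sigma> * (f m)\<^sup>2) + f B * f (Suc B)"
    by (induction B) (simp_all add: hop_def algebra_simps power2_eq_square)
  then show ?thesis using f by simp
qed

definition kap :: real where
  "kap = lam - 4 * \<sigma>"

lemma kap_nonneg: "0 \<le> kap"
  using lam_ge \<sigma> by (simp add: kap_def)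

text \<open>The diagonal contributes \<open>2 * \<sigma> * (f m)\<^sup>2\<close>, and the rest is
  bounded in modulus by \<open>hop_form_bound\<close>. From above the \<sigma> terms cancel; from
  below they double to \<open>4 * \<sigma> * (f m)\<^sup>2\<close>, and \<open>w m \<ge> 1\<close>
  allows dividing this by \<open>w m\<close>.\<close>

lemma hop_form_le:
  assumes f: "f B = 0" "f (Suc B) = 0"
  shows "(\<Sum>m\<le>B. hop f m * f m) \<le> lam * (\<Sum>m\<le>B. (f m)\<^sup>2 / w m)"
    and "- kap * (\<Sum>m\<le>B. (f m)\<^sup>2 / w m) \<le> (\<Sum>m\<le>B. hop f m * f m)"
proof -
  have eq: "(\<Sum>m\<le>B. (lam / w m - 2 * \<sigma>) * (f m)\<^sup>2)
      = lam * (\<Sum>m\<le>B. (f m)\<^sup>2 / w m) - (\<Sum>m\<le>B. 2 * \<sigma> * (f m)\<^sup>2)"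
    by (simp add: sum_distrib_left flip: sum_subtractf) (simp add: algebra_simps)
  show "(\<Sum>m\<le>B. hop f m * f m) \<le> lam * (\<Sum>m\<le>B. (f m)\<^sup>2 / w m)"
    using hop_form_bound[of f B] hop_form_eq[of f B] f eq by linarith
  have "(\<Sum>m\<le>B. 4 * \<sigma> * ((f m)\<^sup>2 / w m)) \<le> (\<Sum>m\<le>B. 4 * \<sigma> * (f m)\<^sup>2)"
    using w_ge_1 \<sigma> by (intro sum_mono mult_left_mono) (auto intro!: divide_le_eq_1_pos[THEN iffD2] simp: divide_le_eq w_pos mult_left_mono mult_le_cancel_left1)
  then have "4 * \<sigma> * (\<Sum>m\<le>B. (f m)\<^sup>2 / w m) \<le> 2 * (\<Sum>m\<le>B. 2 * \<sigma> * (f m)\<^sup>2)"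
    by (simp add: sum_distrib_left mult.assoc)
  then show "- kap * (\<Sum>m\<le>B. (f m)\<^sup>2 / w m) \<le> (\<Sum>m\<le>B. hop f m * f m)"
    using hop_form_bound[of f B] hop_form_eq[of f B] f eq by (simp add: kap_def algebra_simps)
qed

subsection \<open>Ratio limits\<close>

declare G.simps(2) [simp del]

lemma hop_G: "hop (\<lambda>k. G L k n) m = G (Suc L) m n / w m"
  using w_pos[of m] by (simp add: G.simps(2))

abbreviation g :: "nat \<Rightarrow> real" where
  "g L \<equiv> G L 0 0"

text \<open>\<open>f\<close> is \<alpha> A^l e_0 + \<beta> A^(l+1) e_0 with e_0 the unit vector at
  height 0, and \<open>g\<close> is the moment sequence of A at e_0. The support of \<open>f\<close>
  ends at \<open>l + 1\<close>, so \<open>f\<close> vanishes at the cutoff \<open>l + 2\<close>, as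
  \<open>hop_form_le\<close> requires.\<close>

lemma g_form:
  fixes \<alpha> \<beta> :: real and l :: nat
  defines "f \<equiv> \<lambda>m. \<alpha> * G l m 0 + \<beta> * G (Suc l) m 0"
  shows "(\<Sum>m\<le>l+2. (f m)\<^sup>2 / w m) = \<alpha>\<^sup>2 * g (2*l) + 2 * \<alpha> * \<beta> * g (2*l+1) + \<beta>\<^sup>2 * g (2*l+2)" (is ?A)
    and "(\<Sum>m\<le>l+2. hop f m * f m) = \<alpha>\<^sup>2 * g (2*l+1) + 2 * \<alpha> * \<beta> * g (2*l+2) + \<beta>\<^sup>2 * g (2*l+3)" (is ?B)
proof -
  have conv: "(\<Sum>m\<le>l+2. G i m 0 * G j m 0 / w m) = g (i + j)" if "i \<le> l + 2" for i j
    using that by (intro G_convolution) simp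
  have sq: "(\<alpha> * x + \<beta> * y)\<^sup>2 / z = \<alpha>\<^sup>2 * (x * x / z) + 2 * \<alpha> * \<beta> * (x * y / z) + \<beta>\<^sup>2 * (y * y / z)" for x y z :: real
    by (cases "z = 0") (simp_all add: field_simps power2_eq_square)
  have sq2: "(\<alpha> * y + \<beta> * u) / z * (\<alpha> * x + \<beta> * y)
      = \<alpha>\<^sup>2 * (y * x / z) + \<alpha> * \<beta> * (y * y / z) + \<alpha> * \<beta> * (u * x / z) + \<beta>\<^sup>2 * (u * y / z)" for x y z u :: real
    by (cases "z = 0") (simp_all add: field_simps power2_eq_square)
  have "(\<Sum>m\<le>l+2. (f m)\<^sup>2 / w m) = (\<Sum>m\<le>l+2. \<alpha>\<^sup>2 * (G l m 0 * G l m 0 / w m)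
      + 2 * \<alpha> * \<beta> * (G l m 0 * G (Suc l) m 0 / w m) + \<beta>\<^sup>2 * (G (Suc l) m 0 * G (Suc l) m 0 / w m))"
    unfolding f_def sq by simp
  also have "\<dots> = \<alpha>\<^sup>2 * g (l + l) + 2 * \<alpha> * \<beta> * g (l + Suc l) + \<beta>\<^sup>2 * g (Suc l + Suc l)"
    by (simp only: sum.distrib sum_distrib_left[symmetric] conv)
  finally show ?A by (simp add: mult_2[of l])
  have hopf: "hop f m = (\<alpha> * G (Suc l) m 0 + \<beta> * G (Suc (Suc l)) m 0) / w m" for m
    unfolding f_def hop_add hop_mult hop_G by (simp add: add_divide_distrib)
  have "(\<Sum>m\<le>l+2. hop f m * f m) = (\<Sum>m\<le>l+2. \<alpha>\<^sup>2 * (G (Suc l) m 0 * G l m 0 / w m)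
      + \<alpha> * \<beta> * (G (Suc l) m 0 * G (Suc l) m 0 / w m)
      + \<alpha> * \<beta> * (G (Suc (Suc l)) m 0 * G l m 0 / w m) + \<beta>\<^sup>2 * (G (Suc (Suc l)) m 0 * G (Suc l) m 0 / w m))"
    unfolding hopf unfolding f_def sq2 by simp
  also have "\<dots> = \<alpha>\<^sup>2 * g (Suc l + l) + \<alpha> * \<beta> * g (Suc l + Suc l) + \<alpha> * \<beta> * g (Suc (Suc l) + l)
      + \<beta>\<^sup>2 * g (Suc (Suc l) + Suc l)"
    by (simp only: sum.distrib sum_distrib_left[symmetric]) (simp only: conv)
  finally show ?B by (simp add: mult_2[of l] eval_nat_numeral)
qed

lemma g_form_bounds:
  "\<alpha>\<^sup>2 * g (2*l+1) + 2 * \<alpha> * \<beta> * g (2*l+2) + \<beta>\<^sup>2 * g (2*l+3)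
    \<le> lam * (\<alpha>\<^sup>2 * g (2*l) + 2 * \<alpha> * \<beta> * g (2*l+1) + \<beta>\<^sup>2 * g (2*l+2))"
  "- kap * (\<alpha>\<^sup>2 * g (2*l) + 2 * \<alpha> * \<beta> * g (2*l+1) + \<beta>\<^sup>2 * g (2*l+2))
    \<le> \<alpha>\<^sup>2 * g (2*l+1) + 2 * \<alpha> * \<beta> * g (2*l+2) + \<beta>\<^sup>2 * g (2*l+3)"
  using hop_form_le[of "\<lambda>m. \<alpha> * G l m 0 + \<beta> * G (Suc l) m 0" "l + 2"] unfolding g_form
  by (auto simp: G_eq_0)

lemma g_odd_le: "g (2*l+1) \<le> lam * g (2*l)"
  using g_form_bounds(1)[of 1 l 0] by simp

text \<open>\<open>(lam - A) (A + kap)\<close> is a nonnegative form, because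
  \<open>(lam + kap) X Y = X Y X + Y X Y\<close> for \<open>X = lam - A\<close> and \<open>Y = A + kap\<close>.\<close>

lemma g_even_le: "g (2*l+2) \<le> lam * kap * g (2*l) + (lam - kap) * g (2*l+1)"
proof -
  \<comment> \<open>With v = A^l e_0, the choice \<open>\<alpha> = kap\<close>,
    \<open>\<beta> = 1\<close> is the vector Y v, and \<open>\<alpha> = lam\<close>,
    \<open>\<beta> = -1\<close> is X v. The two bounds add up to \<open>lam + kap\<close> times the
    form of X Y at v.\<close>
  have "0 \<le> (lam + kap) * (lam * kap * g (2*l) + (lam - kap) * g (2*l+1) - g (2*l+2))"
    using g_form_bounds(1)[of kap l 1] g_form_bounds(2)[of lam l "-1"]
    by (simp add: algebra_simps power2_eq_square)
  then show ?thesis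
    using lam_pos kap_nonneg by (simp add: zero_le_mult_iff)
qed

lemma g_even_le_sq: "g (2*l+2) \<le> lam\<^sup>2 * g (2*l)"
proof -
  have "(lam - kap) * g (2*l+1) \<le> (lam - kap) * (lam * g (2*l))"
    using g_odd_le \<sigma> by (intro mult_left_mono) (auto simp: kap_def)
  then show ?thesis
    using g_even_le[of l] by (simp add: algebra_simps power2_eq_square)
qed

text \<open>Cauchy-Schwarz for A^l e_0 and A^(l+2) e_0. It makes the ratios of consecutive even
  moments increase.\<close>

lemma g_log_convex: "(g (2*l+2))\<^sup>2 \<le> g (2*l) * g (2*l+4)"
proof -
  have conv: "(\<Sum>m\<le>l+2. G i m 0 * G j m 0 / w m) = g (i + j)" if "i \<le> l + 2" for i j
    using that by (intro G_convolution) simp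
  have "(\<Sum>m\<le>l+2. (G l m 0 / sqrt (w m)) * (G (l+2) m 0 / sqrt (w m)))\<^sup>2
      \<le> (\<Sum>m\<le>l+2. (G l m 0 / sqrt (w m))\<^sup>2) * (\<Sum>m\<le>l+2. (G (l+2) m 0 / sqrt (w m))\<^sup>2)"
    by (rule Cauchy_Schwarz_ineq_sum)
  moreover have "(\<Sum>m\<le>l+2. (G i m 0 / sqrt (w m)) * (G j m 0 / sqrt (w m))) = g (i + j)" if "i \<le> l + 2" for i j
    using conv[OF that, of j] w_pos by (simp add: abs_of_pos flip: real_sqrt_mult)
  ultimately show ?thesis
    by (simp add: power2_eq_square mult_2[of l] eval_nat_numeral)
qed

text \<open>Cauchy--Schwarz applied to \<open>\<langle>A\<^sup>l e\<^sub>0, s\<rangle> = lam\<^sup>l\<close>.\<close>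

lemma g_lower: "(lam ^ l)\<^sup>2 \<le> g (2*l) * (\<Sum>m\<le>l. (s m)\<^sup>2)"
proof -
  have "(\<Sum>m\<le>l. (G l m 0 / sqrt (w m)) * (s m / sqrt (w m)))\<^sup>2
      \<le> (\<Sum>m\<le>l. (G l m 0 / sqrt (w m))\<^sup>2) * (\<Sum>m\<le>l. (s m / sqrt (w m))\<^sup>2)"
    by (rule Cauchy_Schwarz_ineq_sum)
  also have "(\<Sum>m\<le>l. (G l m 0 / sqrt (w m)) * (s m / sqrt (w m))) = lam ^ l"
    using G_eigen[of 0 l l] w_pos by (simp add: abs_of_pos s.simps flip: real_sqrt_mult)
  also have "(\<Sum>m\<le>l. (G l m 0 / sqrt (w m))\<^sup>2) = g (2*l)"
    using G_convolution[of 0 l l l 0] w_pos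
    by (simp add: power2_eq_square abs_of_pos mult_2[of l] flip: real_sqrt_mult)
  also have "g (2*l) * (\<Sum>m\<le>l. (s m / sqrt (w m))\<^sup>2) \<le> g (2*l) * (\<Sum>m\<le>l. (s m)\<^sup>2)"
  proof (intro mult_left_mono sum_mono)
    fix m
    have "(s m / sqrt (w m))\<^sup>2 = (s m)\<^sup>2 / w m"
      using w_pos[of m] by (simp add: power_divide)
    also have "\<dots> \<le> (s m)\<^sup>2 / 1"
      using w_ge_1[of m] w_pos[of m] by (intro divide_left_mono) auto
    finally show "(s m / sqrt (w m))\<^sup>2 \<le> (s m)\<^sup>2" by simp
  qed (rule G_nonneg)
  finally show ?thesis .
qed

text \<open>The ratios increase to some \<open>R \<le> lam\<^sup>2\<close>, hence
  \<open>g (2*l) \<le> R ^ l\<close>. Against \<open>g_lower\<close>, the subexponential growth of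
  \<open>s\<close> excludes \<open>R < lam\<^sup>2\<close>.\<close>

lemma g_even_ratio: "(\<lambda>l. g (2*l+2) / g (2*l)) \<longlonglongrightarrow> lam\<^sup>2"
proof -
  define r where "r l = g (2*l+2) / g (2*l)" for l
  have gp: "0 < g L" for L by (rule G_00_pos)
  have "incseq r"
  proof (rule incseq_SucI)
    fix l
    show "r l \<le> r (Suc l)"
      using g_log_convex[of l] gp[of "2*l"] gp[of "2*l+2"]
      by (simp add: r_def divide_le_eq le_divide_eq power2_eq_square mult.commute eval_nat_numeral)
  qed
  moreover have ub: "r l \<le> lam\<^sup>2" for l
    using g_even_le_sq[of l] gp[of "2*l"] by (simp add: r_def divide_le_eq)
  ultimately obtain R where R: "r \<longlonglongrightarrow> R" "\<And>l. r l \<le> R"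
    using incseq_convergent[of r "lam\<^sup>2"] by blast
  have rp: "0 < r l" for l using gp by (simp add: r_def)
  have Rp: "0 < R" using R(2)[of 0] rp[of 0] by linarith
  have gR: "g (2*l) \<le> R ^ l" for l
  proof (induction l)
    case (Suc l)
    have "g (2 * Suc l) = r l * g (2*l)"
      using gp[of "2*l"] by (simp add: r_def eval_nat_numeral)
    also have "\<dots> \<le> R * R ^ l"
      using Suc R(2)[of l] Rp gp[of "2*l"] by (intro mult_mono) auto
    finally show ?case by simp
  qed (simp add: w_0)
  have key: "lam\<^sup>2 * \<rho> \<le> R" if \<rho>: "0 < \<rho>" "\<rho> < 1" for \<rho>
  proof (rule ccontr)
    assume "\<not> lam\<^sup>2 * \<rho> \<le> R"
    \<comment> \<open>With \<open>t\<close> the fourth root of \<rho>,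
      \<open>(s m)\<^sup>2 * \<rho> ^ m\<close> is
      \<open>(s m * t ^ m)\<^sup>2 * (t\<^sup>2) ^ m\<close>: half of the decay absorbs
      \<open>s\<close>, the other half leaves a geometric series.\<close>
    define t where "t = sqrt (sqrt \<rho>)"
    have t: "0 < t" "t < 1" using \<rho> by (auto simp: t_def)
    have t4: "t\<^sup>2 * t\<^sup>2 = \<rho>" using \<rho> by (simp add: t_def)
    have t2: "t\<^sup>2 < 1" "0 < t\<^sup>2" using t by (auto simp: power_less_one_iff)
    obtain C where C: "0 < C" "\<And>m. s m * t ^ m \<le> C"
      using s_subexponential[OF t] by blast
    define K where "K = C\<^sup>2 / (1 - t\<^sup>2)"
    have sq: "(\<Sum>m\<le>l. (s m)\<^sup>2) * \<rho> ^ l \<le> K" for l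
    proof -
      have "(\<Sum>m\<le>l. (s m)\<^sup>2) * \<rho> ^ l \<le> (\<Sum>m\<le>l. C\<^sup>2 * (t\<^sup>2) ^ m)"
        unfolding sum_distrib_right
      proof (rule sum_mono)
        fix m assume "m \<in> {..l}"
        then have "\<rho> ^ l \<le> \<rho> ^ m" using \<rho> by (intro power_decreasing) auto
        then have "(s m)\<^sup>2 * \<rho> ^ l \<le> (s m)\<^sup>2 * \<rho> ^ m" by (intro mult_left_mono) auto
        also have "\<dots> = (s m * t ^ m)\<^sup>2 * (t\<^sup>2) ^ m"
          by (simp add: t4[symmetric] power_mult_distrib flip: power_mult power_add)
        also have "\<dots> \<le> C\<^sup>2 * (t\<^sup>2) ^ m"
          using C t s_pos[of m] by (intro mult_right_mono power_mono) auto
        finally show "(s m)\<^sup>2 * \<rho> ^ l \<le> C\<^sup>2 * (t\<^sup>2) ^ m" .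
      qed
      also have "\<dots> = C\<^sup>2 * (\<Sum>m\<le>l. (t\<^sup>2) ^ m)" by (simp add: sum_distrib_left)
      also have "\<dots> \<le> C\<^sup>2 * (\<Sum>m. (t\<^sup>2) ^ m)"
        using t2 by (intro mult_left_mono sum_le_suminf summable_geometric) auto
      also have "\<dots> = K" using t2 by (simp add: K_def suminf_geometric)
      finally show ?thesis .
    qed
    have bd: "(lam\<^sup>2 * \<rho> / R) ^ l \<le> K" for l
    proof -
      have "(lam\<^sup>2 * \<rho>) ^ l = (lam ^ l)\<^sup>2 * \<rho> ^ l"
        by (simp add: power_mult_distrib flip: power_mult) (simp add: mult.commute)
      also have "\<dots> \<le> g (2*l) * (\<Sum>m\<le>l. (s m)\<^sup>2) * \<rho> ^ l"
        using g_lower \<rho> by (intro mult_right_mono) auto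
      also have "\<dots> \<le> R ^ l * K"
        unfolding mult.assoc using gR sq Rp \<rho> by (intro mult_mono) (auto intro!: mult_nonneg_nonneg sum_nonneg)
      finally show ?thesis using Rp by (simp add: power_divide divide_le_eq mult.commute)
    qed
    have "1 < lam\<^sup>2 * \<rho> / R" using \<open>\<not> lam\<^sup>2 * \<rho> \<le> R\<close> Rp by (simp add: less_divide_eq)
    then obtain l where "K < (lam\<^sup>2 * \<rho> / R) ^ l"
      using real_arch_pow by blast
    with bd[of l] show False by simp
  qed
  have "lam\<^sup>2 \<le> R"
  proof (rule field_le_mult_one_interval)
    fix z :: real assume "0 < z" "z < 1"
    then show "z * lam\<^sup>2 \<le> R" using key[of z] by (simp add: mult.commute)
  qed
  moreover have "R \<le> lam\<^sup>2" using ub by (intro LIMSEQ_le_const2[OF R(1)]) auto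
  ultimately show ?thesis using R(1) by (simp add: r_def[abs_def])
qed

text \<open>The two-step ratio controls the one-step ratio: \<open>g_even_le\<close> bounds
  \<open>g (2*l+1) / g (2*l)\<close> from below by an affine function of it whose limit is
  \<open>lam\<close>, and \<open>g_odd_le\<close> bounds it from above by \<open>lam\<close>. The
  step from odd to even length follows by division.\<close>

lemma g_ratio: "(\<lambda>L. g (Suc L) / g L) \<longlonglongrightarrow> lam"
proof -
  have gp: "0 < g L" for L by (rule G_00_pos)
  have lk: "lam - kap > 0" using \<sigma> by (simp add: kap_def)
  have odd: "(\<lambda>l. g (2*l+1) / g (2*l)) \<longlonglongrightarrow> lam"
  proof (rule tendsto_sandwich[OF always_eventually always_eventually _ tendsto_const])
    have "(\<lambda>l. (g (2*l+2) / g (2*l) - lam * kap) / (lam - kap)) \<longlonglongrightarrow> (lam\<^sup>2 - lam * kap) / (lam - kap)"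
      using lk by (intro tendsto_intros g_even_ratio) auto
    also have "(lam\<^sup>2 - lam * kap) / (lam - kap) = lam"
      using lk by (simp add: field_simps power2_eq_square)
    finally show "(\<lambda>l. (g (2*l+2) / g (2*l) - lam * kap) / (lam - kap)) \<longlonglongrightarrow> lam" .
    show "\<forall>l. (g (2*l+2) / g (2*l) - lam * kap) / (lam - kap) \<le> g (2*l+1) / g (2*l)"
    proof
      fix l
      have "g (2*l+2) / g (2*l) \<le> (lam * kap * g (2*l) + (lam - kap) * g (2*l+1)) / g (2*l)"
        using g_even_le gp[of "2*l"] by (intro divide_right_mono) auto
      also have "\<dots> = lam * kap + (lam - kap) * (g (2*l+1) / g (2*l))"
        using gp[of "2*l"] by (simp add: add_divide_distrib)
      finally have "g (2*l+2) / g (2*l) - lam * kap \<le> g (2*l+1) / g (2*l) * (lam - kap)"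
        by (simp only: diff_le_eq add.commute mult.commute)
      then show "(g (2*l+2) / g (2*l) - lam * kap) / (lam - kap) \<le> g (2*l+1) / g (2*l)"
        unfolding pos_divide_le_eq[OF lk] .
    qed
    show "\<forall>l. g (2*l+1) / g (2*l) \<le> lam"
      using g_odd_le gp by (simp add: divide_le_eq)
  qed
  have "(\<lambda>l. (g (2*l+2) / g (2*l)) / (g (2*l+1) / g (2*l))) \<longlonglongrightarrow> lam\<^sup>2 / lam"
    using lam_pos by (intro tendsto_divide g_even_ratio odd) auto
  moreover have "(g (2*l+2) / g (2*l)) / (g (2*l+1) / g (2*l)) = g (2*l+2) / g (2*l+1)" for l
    using gp[of "2*l"] by (simp only: divide_divide_eq_left') simp
  ultimately have even: "(\<lambda>l. g (2*l+2) / g (2*l+1)) \<longlonglongrightarrow> lam"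
    using lam_pos by (simp only: power2_eq_square) simp
  show ?thesis
  proof (rule LIMSEQ_I)
    fix e :: real assume "0 < e"
    obtain N1 where N1: "\<And>l. l \<ge> N1 \<Longrightarrow> norm (g (2*l+1) / g (2*l) - lam) < e"
      using LIMSEQ_D[OF odd \<open>0 < e\<close>] by blast
    obtain N2 where N2: "\<And>l. l \<ge> N2 \<Longrightarrow> norm (g (2*l+2) / g (2*l+1) - lam) < e"
      using LIMSEQ_D[OF even \<open>0 < e\<close>] by blast
    have "norm (g (Suc L) / g L - lam) < e" if "L \<ge> 2 * (N1 + N2)" for L
    proof (cases "even L")
      case True
      then obtain l where "L = 2 * l" by blast
      then show ?thesis using N1[of l] that by simp
    next
      case False
      then obtain l where "L = 2 * l + 1" by (blast elim: oddE)
      then show ?thesis using N2[of l] that by simp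
    qed
    then show "\<exists>no. \<forall>n\<ge>no. norm (g (Suc n) / g n - lam) < e" by blast
  qed
qed

text \<open>Solved for the kernel at \<open>Suc k\<close>, the recursion of \<open>G\<close> trades
  one unit of starting height for one unit of length. In the limit the extra length is worth a
  factor \<open>lam\<close>, which leaves the recurrence of \<open>s\<close>.\<close>

lemma G_ratio_step:
  assumes "(\<lambda>L. G L 0 n / g L) \<longlonglongrightarrow> c"
  shows "(\<lambda>L. G L m n / g L) \<longlonglongrightarrow> s m * c"
proof (induction m rule: less_induct)
  case (less m)
  show ?case
  proof (cases m)
    case 0
    then show ?thesis using assms by (simp add: s.simps)
  next
    case (Suc k)
    define P where "P L = (if k = 0 then 0 else G L (k - 1) n)" for L
    have P: "(\<lambda>L. P L / g L) \<longlonglongrightarrow> (if k = 0 then 0 else s (k - 1)) * c"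
      using less.IH[of "k - 1"] Suc by (cases "k = 0") (auto simp: P_def)
    have k: "(\<lambda>L. G L k n / g L) \<longlonglongrightarrow> s k * c"
      using less.IH[of k] Suc by simp
    have "(\<lambda>L. (G (Suc L) k n / g (Suc L)) * (g (Suc L) / g L) / w k - 2 * \<sigma> * (G L k n / g L) - P L / g L)
       \<longlonglongrightarrow> (s k * c) * lam / w k - 2 * \<sigma> * (s k * c) - (if k = 0 then 0 else s (k - 1)) * c"
      using w_pos[of k] by (intro tendsto_intros g_ratio k P LIMSEQ_Suc[OF k]) auto
    moreover have "(G (Suc L) k n / g (Suc L)) * (g (Suc L) / g L) / w k - 2 * \<sigma> * (G L k n / g L) - P L / g L
      = G L m n / g L" for L
    proof -
      have "G (Suc L) k n / w k = hop (\<lambda>j. G L j n) k"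
        by (simp add: hop_G)
      then have "G (Suc L) k n / w k - 2 * \<sigma> * G L k n - P L = G L m n"
        by (simp add: hop_def P_def Suc)
      moreover have "(G (Suc L) k n / g (Suc L)) * (g (Suc L) / g L) = G (Suc L) k n / g L"
        using G_00_pos[of "Suc L"] by simp
      moreover have "x / y / z - 2 * \<sigma> * (u / y) - p / y = (x / z - 2 * \<sigma> * u - p) / y" for x y z u p :: real
        by (simp add: diff_divide_distrib mult.commute)
      ultimately show ?thesis by metis
    qed
    moreover have "(s k * c) * lam / w k - 2 * \<sigma> * (s k * c) - (if k = 0 then 0 else s (k - 1)) * c = s m * c"
      by (simp add: Suc s_Suc algebra_simps)
    ultimately show ?thesis by simp
  qed
qed

lemma G_ratio: "(\<lambda>L. G L m n / g L) \<longlonglongrightarrow> s m * s n"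
proof -
  have "(\<lambda>L. G L 0 0 / g L) \<longlonglongrightarrow> 1"
    by (simp add: less_imp_neq[OF G_00_pos, symmetric])
  then have "(\<lambda>L. G L n 0 / g L) \<longlonglongrightarrow> s n * 1"
    by (rule G_ratio_step)
  then show ?thesis
    by (simp add: G_ratio_step G_commute[of _ 0 n])
qed

section \<open>Bounds uniform in the length and in the end heights\<close>

lemma g_growth: "g (L + j) \<le> lam / (2 * \<sigma>) * lam ^ j * g L"
proof -
  have gp: "0 < g L" for L by (rule G_00_pos)
  have even: "g (2*l + j) \<le> lam ^ j * g (2*l)" for l j
  proof (induction j arbitrary: l rule: less_induct)
    case (less j)
    consider "j = 0" | "j = 1" | i where "j = i + 2"
    proof -
      have "j = 0 \<or> j = 1 \<or> j = (j - 2) + 2" by arith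
      then show ?thesis using that by blast
    qed
    then show ?case
    proof cases
      case 2
      then show ?thesis using g_odd_le[of l] by simp
    next
      case 3
      have "g (2 * Suc l + i) \<le> lam ^ i * g (2 * Suc l)"
        by (rule less.IH) (simp add: 3)
      also have "\<dots> \<le> lam ^ i * (lam\<^sup>2 * g (2*l))"
        using g_even_le_sq[of l] lam_pos by (intro mult_left_mono) auto
      finally show ?thesis
        using 3 by (simp add: power2_eq_square mult_ac add.commute)
    qed simp
  qed
  have c: "1 \<le> lam / (2 * \<sigma>)" using lam_ge \<sigma> by (simp add: le_divide_eq)
  show ?thesis
  proof (cases "even L")
    case True
    then obtain l where L: "L = 2 * l" by blast
    have "1 * (lam ^ j * g L) \<le> lam / (2 * \<sigma>) * (lam ^ j * g L)"
      using c gp[of L] lam_pos by (intro mult_right_mono) auto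
    then show ?thesis using even[of l j] L by (simp add: mult.assoc)
  next
    case False
    then obtain l where L: "L = 2 * l + 1" by (blast elim: oddE)
    \<comment> \<open>The bound with constant 1 starts from even lengths. An odd \<open>L\<close> is
      reached from \<open>L - 1\<close> by a horizontal step at height 0, which costs the factor
      \<open>lam / (2 * \<sigma>)\<close>.\<close>
    have "g (L + j) \<le> lam ^ Suc j * g (2*l)"
      using even[of l "Suc j"] L by simp
    also have "\<dots> \<le> lam ^ Suc j * (g L / (2 * \<sigma>))"
      using G_00_step[of "2*l"] L \<sigma> lam_pos by (intro mult_left_mono) (auto simp: le_divide_eq mult.commute)
    finally show ?thesis by simp
  qed
qed

text \<open>Iterating the inequality expands \<open>S L\<close> into a discounted sum of later
  values \<open>g (L + j)\<close>, geometric of ratio \<open>lam / \<theta>\<close> by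
  \<open>g_growth\<close>; the remainder vanishes by the limit assumption. \<open>K\<close> is fixed
  before \<open>S\<close>, \<open>C\<close> and \<open>L\<close>, which gives uniformity.\<close>

lemma supersolution_bound:
  assumes \<theta>: "lam < \<theta>"
  obtains K where "0 < K"
    "\<And>S C L. 0 \<le> C \<Longrightarrow> (\<And>L. S L \<le> S (Suc L) / \<theta> + C * g L) \<Longrightarrow>
       (\<lambda>L. S L / \<theta> ^ L) \<longlonglongrightarrow> 0 \<Longrightarrow> S L \<le> K * C * g L"
proof -
  define K where "K = lam / (2 * \<sigma>) / (1 - lam / \<theta>)"
  have \<theta>p: "0 < \<theta>" and r: "0 < lam / \<theta>" "lam / \<theta> < 1" using \<theta> lam_pos by auto
  show ?thesis
  proof (rule that[of K])
    show "0 < K" using r lam_pos \<sigma> by (simp add: K_def)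
    fix S :: "nat \<Rightarrow> real" and C L
    assume C: "0 \<le> C" and step: "\<And>L. S L \<le> S (Suc L) / \<theta> + C * g L"
      and lim: "(\<lambda>L. S L / \<theta> ^ L) \<longlonglongrightarrow> 0"
    have iter: "S L \<le> S (L + k) / \<theta> ^ k + C * (\<Sum>j<k. g (L + j) / \<theta> ^ j)" for k
    proof (induction k)
      case (Suc k)
      have "S (L + k) / \<theta> ^ k \<le> (S (Suc (L + k)) / \<theta> + C * g (L + k)) / \<theta> ^ k"
        using step \<theta>p by (intro divide_right_mono) auto
      then show ?case using Suc by (simp add: algebra_simps add_divide_distrib)
    qed simp
    have "(\<Sum>j<k. g (L + j) / \<theta> ^ j) \<le> K * g L" for k
    proof -
      have "(\<Sum>j<k. g (L + j) / \<theta> ^ j) \<le> (\<Sum>j<k. lam / (2 * \<sigma>) * g L * (lam / \<theta>) ^ j)"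
      proof (rule sum_mono)
        fix j
        have "g (L + j) / \<theta> ^ j \<le> (lam / (2 * \<sigma>) * lam ^ j * g L) / \<theta> ^ j"
          using g_growth \<theta>p by (intro divide_right_mono) auto
        then show "g (L + j) / \<theta> ^ j \<le> lam / (2 * \<sigma>) * g L * (lam / \<theta>) ^ j"
          by (simp add: power_divide mult_ac)
      qed
      also have "\<dots> = lam / (2 * \<sigma>) * g L * (\<Sum>j<k. (lam / \<theta>) ^ j)"
        by (simp add: sum_distrib_left)
      also have "\<dots> \<le> lam / (2 * \<sigma>) * g L * (\<Sum>j. (lam / \<theta>) ^ j)"
        using r \<sigma> lam_pos G_nonneg by (intro mult_left_mono sum_le_suminf summable_geometric) auto
      also have "\<dots> = K * g L"
        using r by (simp add: K_def suminf_geometric)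
      finally show ?thesis .
    qed
    then have bound: "S L \<le> S (L + k) / \<theta> ^ k + C * (K * g L)" for k
      using iter[of k] mult_left_mono[OF _ C] by (meson add_left_mono order_trans)
    have "(\<lambda>k. S (k + L) / \<theta> ^ (k + L) * \<theta> ^ L) \<longlonglongrightarrow> 0 * \<theta> ^ L"
      by (intro tendsto_mult LIMSEQ_ignore_initial_segment[OF lim] tendsto_const)
    moreover have "S (k + L) / \<theta> ^ (k + L) * \<theta> ^ L = S (L + k) / \<theta> ^ k" for k
      using \<theta>p by (simp add: power_add add.commute)
    ultimately have "(\<lambda>k. S (L + k) / \<theta> ^ k + C * (K * g L)) \<longlonglongrightarrow> 0 + C * (K * g L)"
      by (intro tendsto_add tendsto_const) simp
    then have "S L \<le> 0 + C * (K * g L)"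
      using bound by (intro LIMSEQ_le_const) auto
    then show "S L \<le> K * C * g L" by (simp add: mult_ac)
  qed
qed

text \<open>For large \<open>m\<close> the sequence \<open>\<tau>\<^sup>m\<close> grows by a factor larger than \<open>lam\<close> under the path
  kernel, whereas \<open>\<Sum>m. \<tau>\<^sup>m G L m n\<close> grows only like \<open>lam\<^sup>L\<close>; so this sum is governed by its
  terms with small \<open>m\<close>.\<close>

lemma G_domination:
  assumes \<tau>: "0 < \<tau>" "\<tau> < 1"
  obtains C where "0 < C" "\<And>L m n. \<tau> ^ m * \<tau> ^ n * G L m n \<le> C * g L"
proof -
  \<comment> \<open>Away from height 0, \<open>hop\<close> multiplies \<open>\<tau> ^ m\<close> by
    \<open>\<tau> + 2 * \<sigma> + 1 / \<tau>\<close>. By AM-GM this exceeds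
    \<open>2 + 2 * \<sigma>\<close> strictly, which leaves room for a rate \<theta> above
    \<open>lam\<close>.\<close>
  have "0 < (1 - \<tau>)\<^sup>2 / \<tau>" using \<tau> by simp
  also have "(1 - \<tau>)\<^sup>2 / \<tau> = \<tau> + 1 / \<tau> - 2"
    using \<tau> by (simp add: field_simps power2_eq_square)
  finally have "2 * (1 + \<sigma>) < \<tau> + 2 * \<sigma> + 1 / \<tau>" by simp
  then have "lam < 1 / (1 - q) * (\<tau> + 2 * \<sigma> + 1 / \<tau>)"
    using q unfolding lam_def by (simp add: divide_strict_right_mono)
  then obtain \<theta> where \<theta>: "lam < \<theta>" "\<theta> < 1 / (1 - q) * (\<tau> + 2 * \<sigma> + 1 / \<tau>)"
    using dense by blast
  have "(\<lambda>m. w m * (\<tau> + 2 * \<sigma> + 1 / \<tau>)) \<longlonglongrightarrow> 1 / (1 - q) * (\<tau> + 2 * \<sigma> + 1 / \<tau>)"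
    by (intro tendsto_intros w_tendsto)
  then have "eventually (\<lambda>m. \<theta> < w m * (\<tau> + 2 * \<sigma> + 1 / \<tau>)) sequentially"
    using \<theta>(2) by (rule order_tendstoD)
  then obtain M where M: "\<And>m. m \<ge> M \<Longrightarrow> \<theta> < w m * (\<tau> + 2 * \<sigma> + 1 / \<tau>)"
    by (auto simp: eventually_sequentially)
  have \<theta>p: "0 < \<theta>" using \<theta> lam_pos by linarith
  obtain K where K: "0 < K" "\<And>S C L. 0 \<le> C \<Longrightarrow> (\<And>L. S L \<le> S (Suc L) / \<theta> + C * g L) \<Longrightarrow>
       (\<lambda>L. S L / \<theta> ^ L) \<longlonglongrightarrow> 0 \<Longrightarrow> S L \<le> K * C * g L"
    using supersolution_bound[OF \<theta>(1)] by blast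
  have grow: "\<theta> * \<tau> ^ m \<le> hop (\<lambda>m. w m * \<tau> ^ m) m" if mM: "m > M" for m
  proof -
    obtain k where m: "m = Suc k" using mM by (cases m) auto
    \<comment> \<open>Of the weights at \<open>k\<close>, \<open>m = Suc k\<close> and
      \<open>Suc m\<close>, \<open>w k\<close> is the smallest. The choice of \<open>M\<close> is
      applied at \<open>k\<close>, hence the strict \<open>m > M\<close>.\<close>
    have "\<theta> * \<tau> ^ m \<le> w k * (\<tau> + 2 * \<sigma> + 1 / \<tau>) * \<tau> ^ m"
      using M[of k] mM m \<tau> by (intro mult_right_mono) auto
    also have "\<dots> = w k * \<tau> ^ Suc m + 2 * \<sigma> * (w k * \<tau> ^ m) + w k * \<tau> ^ k"
      using \<tau> m by (simp add: field_simps)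
    also have "\<dots> \<le> w (Suc m) * \<tau> ^ Suc m + 2 * \<sigma> * (w m * \<tau> ^ m) + w k * \<tau> ^ k"
      using w_mono[of k] w_mono[of m] m \<tau> \<sigma> by (intro add_mono mult_mono mult_left_mono) (auto intro: less_imp_le[OF w_pos])
    also have "\<dots> = hop (\<lambda>m. w m * \<tau> ^ m) m" using m by (simp add: hop_def)
    finally show ?thesis .
  qed
  define S where "S n L = (\<Sum>m\<le>n+L. \<tau> ^ m * G L m n)" for n L
  have S_ge: "\<tau> ^ m * G L m n \<le> S n L" for m n L
  proof (cases "m \<le> n + L")
    case True
    then show ?thesis unfolding S_def using \<tau> G_nonneg by (intro member_le_sum) auto
  next
    case False
    then show ?thesis unfolding S_def using \<tau> G_nonneg by (auto simp: G_eq_0 intro!: sum_nonneg)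
  qed
  \<comment> \<open>Growth by \<theta> is known only above \<open>M\<close>; the heights up to
    \<open>M\<close> form the error term.\<close>
  have S_step: "S n L \<le> S n (Suc L) / \<theta> + (\<Sum>m\<le>M. G L m n)" for n L
  proof -
    have "S n (Suc L) = (\<Sum>m<Suc (n + Suc L). hop (\<lambda>m. G L m n) m * (w m * \<tau> ^ m))"
      unfolding S_def by (intro sum.cong) (auto simp: G.simps(2))
    also have "\<dots> = (\<Sum>m<Suc (n + Suc L). G L m n * hop (\<lambda>m. w m * \<tau> ^ m) m)"
      by (intro sum_hop_commute) (auto intro: G_eq_0)
    also have "\<dots> = (\<Sum>m\<le>n+L. G L m n * hop (\<lambda>m. w m * \<tau> ^ m) m)"
      by (simp add: lessThan_Suc_atMost G_eq_0)
    finally have eq: "S n (Suc L) = (\<Sum>m\<le>n+L. G L m n * hop (\<lambda>m. w m * \<tau> ^ m) m)" .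
    have "\<theta> * S n L = (\<Sum>m\<le>n+L. G L m n * (\<theta> * \<tau> ^ m))"
      by (simp add: S_def sum_distrib_left mult_ac)
    also have "\<dots> \<le> (\<Sum>m\<le>n+L. G L m n * hop (\<lambda>m. w m * \<tau> ^ m) m + (if m \<le> M then \<theta> * G L m n else 0))"
    proof (rule sum_mono)
      fix m
      show "G L m n * (\<theta> * \<tau> ^ m) \<le> G L m n * hop (\<lambda>m. w m * \<tau> ^ m) m + (if m \<le> M then \<theta> * G L m n else 0)"
      proof (cases "m \<le> M")
        case True
        have "G L m n * (\<theta> * \<tau> ^ m) \<le> G L m n * (\<theta> * 1)"
          using \<tau> \<theta>p G_nonneg by (intro mult_left_mono power_le_one) auto
        moreover have "0 \<le> G L m n * hop (\<lambda>m. w m * \<tau> ^ m) m"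
          using \<tau> G_nonneg by (intro mult_nonneg_nonneg hop_nonneg) (auto intro: less_imp_le[OF w_pos])
        ultimately show ?thesis using True by (simp add: mult.commute)
      next
        case False
        then show ?thesis using grow[of m] G_nonneg by (auto intro!: mult_left_mono)
      qed
    qed
    also have "\<dots> = S n (Suc L) + \<theta> * (\<Sum>m\<le>n+L. if m \<le> M then G L m n else 0)"
      unfolding sum.distrib eq sum_distrib_left by (auto intro!: sum.cong)
    also have "(\<Sum>m\<le>n+L. if m \<le> M then G L m n else 0) = (\<Sum>m\<in>{m \<in> {..n+L}. m \<le> M}. G L m n)"
      by (rule sum.inter_filter[symmetric]) simp
    also have "\<dots> \<le> (\<Sum>m\<le>M. G L m n)"
      using G_nonneg by (intro sum_mono2) auto
    finally have "\<theta> * S n L \<le> S n (Suc L) + \<theta> * (\<Sum>m\<le>M. G L m n)" using \<theta>p by simp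
    then show ?thesis using \<theta>p by (simp add: field_simps)
  qed
  have S_lim: "(\<lambda>L. S n L / \<theta> ^ L) \<longlonglongrightarrow> 0" for n
  proof (rule tendsto_sandwich[OF always_eventually always_eventually tendsto_const])
    show "\<forall>L. 0 \<le> S n L / \<theta> ^ L"
      unfolding S_def using \<tau> \<theta>p G_nonneg by (auto intro!: sum_nonneg divide_nonneg_nonneg)
    \<comment> \<open>A crude bound suffices: \<open>\<tau> ^ m \<le> 1 \<le> s m\<close> reduces
      the sum to \<open>G_eigen\<close>, so it grows at most like \<open>lam ^ L\<close>, more
      slowly than \<open>\<theta> ^ L\<close>.\<close>
    have "S n L \<le> 1 / (1 - q) * (lam ^ L * s n)" for L
    proof -
      have "S n L \<le> (\<Sum>m\<le>n+L. 1 / (1 - q) * (G L m n * s m / w m))"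
        unfolding S_def
      proof (rule sum_mono)
        fix m
        have "\<tau> ^ m * G L m n \<le> s m * G L m n"
          using \<tau> s_ge_1[of m] power_le_one[of \<tau> m] G_nonneg by (intro mult_right_mono) auto
        also have "\<dots> = w m * (G L m n * s m / w m)" using w_pos[of m] by simp
        also have "\<dots> \<le> 1 / (1 - q) * (G L m n * s m / w m)"
          using w_le[of m] G_nonneg less_imp_le[OF s_pos] less_imp_le[OF w_pos] by (intro mult_right_mono) auto
        finally show "\<tau> ^ m * G L m n \<le> 1 / (1 - q) * (G L m n * s m / w m)" .
      qed
      then show ?thesis
        unfolding sum_distrib_left[symmetric] by (simp add: G_eigen)
    qed
    then have "S n L / \<theta> ^ L \<le> 1 / (1 - q) * (lam ^ L * s n) / \<theta> ^ L" for L
      using \<theta>p by (intro divide_right_mono) auto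
    then show "\<forall>L. S n L / \<theta> ^ L \<le> 1 / (1 - q) * s n * (lam / \<theta>) ^ L"
      by (simp add: power_divide mult_ac)
    have "(\<lambda>L. 1 / (1 - q) * s n * (lam / \<theta>) ^ L) \<longlonglongrightarrow> 1 / (1 - q) * s n * 0"
      using \<theta> lam_pos by (intro tendsto_intros LIMSEQ_power_zero) auto
    then show "(\<lambda>L. 1 / (1 - q) * s n * (lam / \<theta>) ^ L) \<longlonglongrightarrow> 0" by simp
  qed
  \<comment> \<open>First pass, with \<open>n\<close> fixed: relative to \<open>g L\<close> the
    error term is a finite sum of convergent ratios. The constant still depends on
    \<open>n\<close>.\<close>
  have "\<exists>c. 0 \<le> c \<and> (\<forall>L m. \<tau> ^ m * G L m n \<le> c * g L)" for n
  proof -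
    have "convergent (\<lambda>L. \<Sum>m\<le>M. G L m n / g L)"
      using G_ratio[of _ n] by (intro convergent_sum) (auto simp: convergent_def)
    then have "Bseq (\<lambda>L. \<Sum>m\<le>M. G L m n / g L)"
      by (rule convergent_imp_Bseq)
    then obtain D where D: "0 < D" "\<forall>L. norm (\<Sum>m\<le>M. G L m n / g L) \<le> D"
      by (rule BseqE)
    have "(\<Sum>m\<le>M. G L m n) \<le> D * g L" for L
      using D(2)[rule_format, of L] G_00_pos[of L] by (simp add: divide_le_eq flip: sum_divide_distrib)
    then have "S n L \<le> S n (Suc L) / \<theta> + D * g L" for L
      using S_step[of n L] by (meson add_left_mono order_trans)
    then have "S n L \<le> K * D * g L" for L
      using K(2)[of D "S n" L] D(1) S_lim by simp
    then have "\<tau> ^ m * G L m n \<le> K * D * g L" for L m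
      using S_ge[of m L n] order_trans by blast
    then show ?thesis
      using D(1) K(1) by (intro exI[of _ "K * D"]) auto
  qed
  then obtain c where c: "\<And>n. 0 \<le> c n" "\<And>n L m. \<tau> ^ m * G L m n \<le> c n * g L" by metis
  define D where "D = (\<Sum>m\<le>M. c m)"
  have D: "0 \<le> D" unfolding D_def using c by (intro sum_nonneg)
  \<comment> \<open>Second pass, with the weight \<open>\<tau> ^ n\<close> included: by symmetry the
    first pass bounds \<open>\<tau> ^ n * G L m n\<close> by \<open>c m * g L\<close>, and only the
    finitely many \<open>c m\<close> with \<open>m \<le> M\<close> occur. This removes the
    dependence on \<open>n\<close>.\<close>
  have "S n L * \<tau> ^ n \<le> K * D * g L" for n L
  proof (rule K(2)[of D "\<lambda>L. S n L * \<tau> ^ n"])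
    fix L
    have "\<tau> ^ n * (\<Sum>m\<le>M. G L m n) \<le> (\<Sum>m\<le>M. c m * g L)"
      unfolding sum_distrib_left using c(2)[of n L] by (intro sum_mono) (simp add: G_commute[of L _ n])
    also have "\<dots> = D * g L" by (simp add: D_def sum_distrib_right)
    finally have "\<tau> ^ n * (\<Sum>m\<le>M. G L m n) \<le> D * g L" .
    moreover have "S n L * \<tau> ^ n \<le> (S n (Suc L) / \<theta> + (\<Sum>m\<le>M. G L m n)) * \<tau> ^ n"
      using S_step \<tau> by (intro mult_right_mono) auto
    ultimately show "S n L * \<tau> ^ n \<le> S n (Suc L) * \<tau> ^ n / \<theta> + D * g L"
      by (simp add: distrib_right mult.commute[of "sum _ _"])
  next
    show "(\<lambda>L. S n L * \<tau> ^ n / \<theta> ^ L) \<longlonglongrightarrow> 0"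
      using tendsto_mult[OF S_lim[of n] tendsto_const[of "\<tau> ^ n"]] by simp
  qed (rule D)
  moreover have "\<tau> ^ m * \<tau> ^ n * G L m n \<le> S n L * \<tau> ^ n" for m n L
    using mult_right_mono[OF S_ge[of m L n], of "\<tau> ^ n"] \<tau> by (simp add: mult_ac)
  ultimately have "\<tau> ^ m * \<tau> ^ n * G L m n \<le> K * D * g L" for m n L
    by (meson order_trans)
  moreover have "K * D * g L \<le> (K * D + 1) * g L" for L
    using G_nonneg[of L 0 0] by (simp add: distrib_right)
  ultimately have "\<tau> ^ m * \<tau> ^ n * G L m n \<le> (K * D + 1) * g L" for m n L
    by (meson order_trans)
  then show ?thesis
    using K(1) D by (intro that[of "K * D + 1"]) (auto intro: add_nonneg_pos)
qed

end

section \<open>Sums over Motzkin paths\<close>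

lemma motzkin_paths_Cons:
  assumes "\<gamma> \<noteq> []"
  shows "x # \<gamma> \<in> motzkin_paths (Suc L) \<longleftrightarrow>
    int (\<gamma> ! 0) - int x \<in> {-1, 0, 1} \<and> \<gamma> \<in> motzkin_paths L"
proof -
  have set: "{1..Suc L} = insert 1 (Suc ` {1..L})"
    by (auto simp: image_Suc_atLeastAtMost)
  have all: "(\<forall>j\<in>{1..Suc L}. P j) \<longleftrightarrow> P 1 \<and> (\<forall>j\<in>{1..L}. P (Suc j))" for P
    unfolding set by blast
  show ?thesis
    unfolding motzkin_paths_def mem_Collect_eq all by (auto simp: nth_Cons')
qed

lemma horizontal_steps_Cons:
  "horizontal_steps (Suc L) (x # \<gamma>) = (if \<gamma> ! 0 = x then 1 else 0) + horizontal_steps L \<gamma>"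
proof -
  have "{j \<in> {1..Suc L}. (x # \<gamma>) ! j = (x # \<gamma>) ! (j - 1)} =
      {j \<in> {1}. \<gamma> ! 0 = x} \<union> Suc ` {j \<in> {1..L}. \<gamma> ! j = \<gamma> ! (j - 1)}" (is "?A = ?B \<union> Suc ` ?C")
  proof (rule set_eqI)
    fix j
    show "j \<in> ?A \<longleftrightarrow> j \<in> ?B \<union> Suc ` ?C"
      by (cases j rule: nat.exhaust; cases "j - 1") (auto simp: image_iff nth_Cons')
  qed
  moreover have "card (?B \<union> Suc ` ?C) = card ?B + card (Suc ` ?C)"
    by (intro card_Un_disjoint) auto
  moreover have "card (Suc ` ?C) = card ?C" by (intro card_image) auto
  moreover have "card ?B = (if \<gamma> ! 0 = x then 1 else 0)" by auto
  ultimately show ?thesis by (simp only: horizontal_steps_def)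
qed

lemma motzkin_paths_rev: "rev \<gamma> \<in> motzkin_paths L \<longleftrightarrow> \<gamma> \<in> motzkin_paths L"
proof -
  have imp: "rev \<gamma> \<in> motzkin_paths L" if g: "\<gamma> \<in> motzkin_paths L" for \<gamma>
  proof -
    have len: "length \<gamma> = Suc L" using g by (simp add: motzkin_paths_def)
    have st: "int (\<gamma> ! i) - int (\<gamma> ! (i - 1)) \<in> {-1, 0, 1}" if "i \<in> {1..L}" for i
      using g that unfolding motzkin_paths_def mem_Collect_eq by (elim conjE) (rule bspec)
    have "int (rev \<gamma> ! j) - int (rev \<gamma> ! (j - 1)) \<in> {-1, 0, 1}" if j: "j \<in> {1..L}" for j
    proof -
      have "int (\<gamma> ! (Suc L - j)) - int (\<gamma> ! (Suc L - j - 1)) \<in> {-1, 0, 1}"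
        by (rule st) (use j in auto)
      moreover have "rev \<gamma> ! j = \<gamma> ! (Suc L - j - 1)" "rev \<gamma> ! (j - 1) = \<gamma> ! (Suc L - j)"
        using j len by (auto simp: rev_nth Suc_diff_le)
      ultimately show ?thesis by auto
    qed
    then show ?thesis using len by (simp add: motzkin_paths_def)
  qed
  show ?thesis using imp[of \<gamma>] imp[of "rev \<gamma>"] by auto
qed

text \<open>\<open>ys\<close> lists the final heights backwards from the end, as the reversed
  process does. For small \<open>L\<close> the two segments may overlap.\<close>

definition path_event :: "nat \<Rightarrow> nat list \<Rightarrow> nat list \<Rightarrow> nat list set" where
  "path_event L xs ys =
    {\<gamma> \<in> motzkin_paths L. take (length xs) \<gamma> = xs \<and> take (length ys) (rev \<gamma>) = ys}"

lemma path_event_hd_last: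
  assumes "\<gamma> \<in> path_event L (x # xs) (y # ys)"
  shows "\<gamma> ! 0 = x" "\<gamma> ! L = y"
proof -
  from assms have len: "length \<gamma> = Suc L" and t: "take (Suc (length xs)) \<gamma> = x # xs"
    "take (Suc (length ys)) (rev \<gamma>) = y # ys"
    by (auto simp: path_event_def motzkin_paths_def)
  show "\<gamma> ! 0 = x" using arg_cong[OF t(1), of "\<lambda>l. l ! 0"] by simp
  show "\<gamma> ! L = y" using arg_cong[OF t(2), of "\<lambda>l. l ! 0"] len by (simp add: rev_nth)
qed

text \<open>The prescribed first height is what gives finiteness; \<open>motzkin_paths L\<close>
  itself is infinite.\<close>

lemma finite_path_event: "finite (path_event L (x # xs) ys)"
proof (rule finite_subset)
  show "path_event L (x # xs) ys \<subseteq> {\<gamma> \<in> motzkin_paths L. \<gamma> ! 0 = x}"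
  proof
    fix \<gamma> assume "\<gamma> \<in> path_event L (x # xs) ys"
    then have "\<gamma> \<in> motzkin_paths L" and t: "take (Suc (length xs)) \<gamma> = x # xs"
      by (auto simp: path_event_def)
    moreover have "\<gamma> ! 0 = x" using arg_cong[OF t, of "\<lambda>l. l ! 0"] by simp
    ultimately show "\<gamma> \<in> {\<gamma> \<in> motzkin_paths L. \<gamma> ! 0 = x}" by simp
  qed
qed (use motzkin_paths_from in blast)

context motzkin_params
begin

definition step_weight :: "nat \<Rightarrow> nat \<Rightarrow> real" where
  "step_weight m n = (if m = n then 2 * \<sigma> else if m = Suc n \<or> n = Suc m then 1 else 0)"

lemma step_weight_commute: "step_weight m n = step_weight n m"
  by (auto simp: step_weight_def)

lemma step_weight_nonzero: "step_weight m n \<noteq> 0 \<longleftrightarrow> int n - int m \<in> {-1, 0, 1}"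
  using \<sigma> by (auto simp: step_weight_def)

lemma hop_eq_sum: "hop f m = (\<Sum>k\<in>{m-1..Suc m}. step_weight m k * f k)"
proof (cases m)
  case 0
  then have "{m-1..Suc m} = {0, 1}" by auto
  then show ?thesis using 0 by (simp add: hop_def step_weight_def)
next
  case (Suc j)
  then have "{m-1..Suc m} = {j, Suc j, Suc (Suc j)}" by auto
  then show ?thesis using Suc by (simp add: hop_def step_weight_def)
qed

fun path_weight :: "nat list \<Rightarrow> real" where
  "path_weight [] = 1"
| "path_weight [x] = w x"
| "path_weight (x # y # xs) = w x * step_weight x y * path_weight (y # xs)"

text \<open>Unlike in \<open>path_weight\<close>, the last height carries no factor
  \<open>w\<close>; the kernel \<open>G\<close> that continues the segment supplies it.\<close>

fun chain_weight :: "nat list \<Rightarrow> real" where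
  "chain_weight [] = 1"
| "chain_weight [x] = 1"
| "chain_weight (x # y # xs) = w x * step_weight x y * chain_weight (y # xs)"

lemma path_weight_snoc:
  "\<gamma> \<noteq> [] \<Longrightarrow> path_weight (\<gamma> @ [x]) = path_weight \<gamma> * step_weight (last \<gamma>) x * w x"
  by (induction \<gamma> rule: path_weight.induct) auto

lemma chain_weight_snoc:
  "\<gamma> \<noteq> [] \<Longrightarrow> chain_weight (\<gamma> @ [x]) = chain_weight \<gamma> * (w (last \<gamma>) * step_weight (last \<gamma>) x)"
  by (induction \<gamma> rule: chain_weight.induct) auto

lemma path_weight_rev: "path_weight (rev \<gamma>) = path_weight \<gamma>"
proof (induction \<gamma> rule: path_weight.induct)
  case (3 x y xs)
  have "path_weight (rev (x # y # xs)) = path_weight (rev (y # xs)) * step_weight (last (rev (y # xs))) x * w x"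
    using path_weight_snoc[of "rev (y # xs)" x] by simp
  then show ?case using 3 by (simp add: step_weight_commute[of y x])
qed auto

lemma motzkin_weight_eq:
  "\<gamma> \<in> motzkin_paths L \<Longrightarrow>
    motzkin_weight \<rho>0 \<rho>1 \<sigma> q L \<gamma> = \<rho>0 ^ (\<gamma> ! 0) * \<rho>1 ^ (\<gamma> ! L) * path_weight \<gamma>"
proof -
  have "(2 * \<sigma>) ^ horizontal_steps L \<gamma> * (\<Prod>k\<in>{0..L}. w (\<gamma> ! k)) = path_weight \<gamma>"
    if "\<gamma> \<in> motzkin_paths L"
    using that
  proof (induction \<gamma> arbitrary: L rule: path_weight.induct)
    case 1
    then show ?case by (simp add: motzkin_paths_def)
  next
    case (2 x)
    then show ?case by (simp add: motzkin_paths_def horizontal_steps_def)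
  next
    case (3 x y xs)
    then obtain K where L: "L = Suc K" by (cases L) (auto simp: motzkin_paths_def)
    have st: "int y - int x \<in> {-1, 0, 1}" and p: "y # xs \<in> motzkin_paths K"
      using 3(2) motzkin_paths_Cons[of "y # xs" x K] L by auto
    have sw: "step_weight x y = (2 * \<sigma>) ^ (if y = x then 1 else 0)"
      using st by (auto simp: step_weight_def)
    have "(\<Prod>k\<in>{0..L}. w ((x # y # xs) ! k)) = w x * (\<Prod>k\<in>{0..K}. w ((y # xs) ! k))"
      unfolding L by (subst prod.atLeast0_atMost_Suc_shift) simp
    then show ?case
      using 3(1)[OF p] by (simp add: L horizontal_steps_Cons power_add sw)
  qed
  then show "\<gamma> \<in> motzkin_paths L \<Longrightarrow>
    motzkin_weight \<rho>0 \<rho>1 \<sigma> q L \<gamma> = \<rho>0 ^ (\<gamma> ! 0) * \<rho>1 ^ (\<gamma> ! L) * path_weight \<gamma>"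
    by (simp add: motzkin_weight_def w_def mult.assoc)
qed

definition event_weight :: "nat \<Rightarrow> nat list \<Rightarrow> nat list \<Rightarrow> real" where
  "event_weight L xs ys = sum path_weight (path_event L xs ys)"

lemma path_event_rev: "path_event L ys xs = rev ` path_event L xs ys"
proof -
  have "\<gamma> \<in> rev ` path_event L xs ys \<longleftrightarrow> rev \<gamma> \<in> path_event L xs ys" for \<gamma>
    by (metis image_iff rev_rev_ident)
  then show ?thesis by (auto simp: path_event_def motzkin_paths_rev)
qed

lemma event_weight_commute: "event_weight L xs ys = event_weight L ys xs"
  unfolding event_weight_def path_event_rev[of L ys xs]
  by (simp add: sum.reindex path_weight_rev)

text \<open>The bound on \<open>length ys\<close> keeps the deleted first height out of the final
  segment, so the condition on \<open>ys\<close> is unaffected.\<close>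

lemma event_weight_Cons:
  assumes "length ys \<le> Suc L"
  shows "event_weight (Suc L) (x # x' # xs) ys = w x * step_weight x x' * event_weight L (x' # xs) ys"
proof -
  have mem: "x # \<gamma> \<in> path_event (Suc L) (x # x' # xs) ys \<longleftrightarrow>
      step_weight x x' \<noteq> 0 \<and> \<gamma> \<in> path_event L (x' # xs) ys" for \<gamma>
  proof (cases "\<gamma> = []")
    case False
    then have "take (Suc (length xs)) \<gamma> = x' # xs \<Longrightarrow> \<gamma> ! 0 = x'"
      by (cases \<gamma>) auto
    moreover have "length \<gamma> = Suc L \<Longrightarrow> take (length ys) (rev \<gamma> @ [x]) = take (length ys) (rev \<gamma>)"
      using assms by simp
    ultimately show ?thesis
      using motzkin_paths_Cons[OF False, of x L]
      by (auto simp: path_event_def step_weight_nonzero motzkin_paths_def[of L])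
  qed (auto simp: path_event_def motzkin_paths_def)
  have ex: "\<exists>\<gamma>'. \<gamma> = x # \<gamma>'" if "\<gamma> \<in> path_event (Suc L) (x # x' # xs) ys" for \<gamma>
    using that by (cases \<gamma>) (auto simp: path_event_def)
  show ?thesis
  proof (cases "step_weight x x' = 0")
    case True
    then have "path_event (Suc L) (x # x' # xs) ys = {}" using ex mem by blast
    then show ?thesis using True by (simp add: event_weight_def)
  next
    case False
    then have eq: "path_event (Suc L) (x # x' # xs) ys = (#) x ` path_event L (x' # xs) ys"
      using ex mem by blast
    have "path_weight (x # \<gamma>) = w x * step_weight x x' * path_weight \<gamma>"
      if "\<gamma> \<in> path_event L (x' # xs) ys" for \<gamma>
      using that by (cases \<gamma>) (auto simp: path_event_def)
    then show ?thesis
      unfolding event_weight_def eq by (simp add: sum.reindex sum_distrib_left)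
  qed
qed

lemma event_weight_singletons: "event_weight L [m] [n] = G L m n"
proof (induction L arbitrary: m)
  case 0
  have "path_event 0 [m] [n] = (if m = n then {[m]} else {})"
    by (auto simp: path_event_def motzkin_paths_def length_Suc_conv)
  then show ?case by (simp add: event_weight_def)
next
  case (Suc L)
  have sub: "path_event (Suc L) [m] [n] = (\<Union>k\<in>{m-1..Suc m}. path_event (Suc L) [m, k] [n])"
  proof (intro equalityI subsetI)
    fix \<gamma> assume g: "\<gamma> \<in> path_event (Suc L) [m] [n]"
    then obtain k \<delta> where \<gamma>: "\<gamma> = m # k # \<delta>"
      by (auto simp: path_event_def motzkin_paths_def length_Suc_conv)
    then have "int k - int m \<in> {-1, 0, 1}"
      using g motzkin_paths_Cons[of "k # \<delta>" m L] by (auto simp: path_event_def)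
    then show "\<gamma> \<in> (\<Union>k\<in>{m-1..Suc m}. path_event (Suc L) [m, k] [n])"
      using g \<gamma> by (intro UN_I[of k]) (auto simp: path_event_def)
  next
    fix \<gamma> assume "\<gamma> \<in> (\<Union>k\<in>{m-1..Suc m}. path_event (Suc L) [m, k] [n])"
    then show "\<gamma> \<in> path_event (Suc L) [m] [n]"
      by (cases \<gamma>) (auto simp: path_event_def)
  qed
  have "event_weight (Suc L) [m] [n] = (\<Sum>k\<in>{m-1..Suc m}. event_weight (Suc L) [m, k] [n])"
    unfolding event_weight_def sub
  proof (rule sum.UNION_disjoint)
    show "\<forall>i\<in>{m-1..Suc m}. \<forall>j\<in>{m-1..Suc m}. i \<noteq> j \<longrightarrow>
        path_event (Suc L) [m, i] [n] \<inter> path_event (Suc L) [m, j] [n] = {}"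
      by (auto simp: path_event_def)
  qed (auto intro: finite_path_event)
  also have "\<dots> = (\<Sum>k\<in>{m-1..Suc m}. w m * (step_weight m k * G L k n))"
    using Suc by (intro sum.cong) (auto simp: event_weight_Cons)
  also have "\<dots> = G (Suc L) m n"
    by (simp only: G.simps(2) hop_eq_sum sum_distrib_left)
  finally show ?case .
qed

lemma event_weight_prefix:
  "length ys \<le> Suc L \<Longrightarrow>
    event_weight (L + length xs) (x # xs) ys = chain_weight (x # xs) * event_weight L [last (x # xs)] ys"
  by (induction xs arbitrary: x) (auto simp: event_weight_Cons)

text \<open>The initial segment is peeled off from the left, the final one likewise after reversal.
  The length counts the steps: those inside the two segments and the \<open>L\<close> steps between
  them.\<close>

lemma event_weight_eq:
  "event_weight (L + length ys + length xs) (x # xs) (y # ys)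
    = chain_weight (x # xs) * chain_weight (y # ys) * G L (last (x # xs)) (last (y # ys))"
proof -
  have "event_weight (L + length ys + length xs) (x # xs) (y # ys)
      = chain_weight (x # xs) * event_weight (L + length ys) [last (x # xs)] (y # ys)"
    by (rule event_weight_prefix) simp
  also have "event_weight (L + length ys) [last (x # xs)] (y # ys)
      = event_weight (L + length ys) (y # ys) [last (x # xs)]"
    by (rule event_weight_commute)
  also have "\<dots> = chain_weight (y # ys) * event_weight L [last (y # ys)] [last (x # xs)]"
    by (rule event_weight_prefix) simp
  also have "event_weight L [last (y # ys)] [last (x # xs)] = G L (last (x # xs)) (last (y # ys))"
    by (simp only: event_weight_singletons G_commute)
  finally show ?thesis by simp
qed

end

section \<open>Boundary weights, the normalizing constant and segment probabilities\<close>

locale motzkin_boundary = motzkin_params +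
  fixes \<rho>0 \<rho>1 :: real
  assumes \<rho>: "0 \<le> \<rho>0" "\<rho>0 < 1" "0 \<le> \<rho>1" "\<rho>1 < 1"
begin

abbreviation "Z L \<equiv> motzkin_norm \<rho>0 \<rho>1 \<sigma> q L"
abbreviation "pathpmf L \<equiv> motzkin_pmf \<rho>0 \<rho>1 \<sigma> q L"

lemma Z_pos: "0 < Z L"
  by (rule motzkin_norm_pos) (use q \<sigma> \<rho> in auto)

lemma pmf_pathpmf:
  "pmf (pathpmf L) \<gamma> = (if \<gamma> \<in> motzkin_paths L then motzkin_weight \<rho>0 \<rho>1 \<sigma> q L \<gamma> / Z L else 0)"
  by (rule pmf_motzkin_pmf) (use q \<sigma> \<rho> in auto)

lemma set_pathpmf: "set_pmf (pathpmf L) \<subseteq> motzkin_paths L"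
  by (auto simp: set_pmf_eq pmf_pathpmf split: if_splits)

lemma prob_path_event:
  "measure (pathpmf L) {\<gamma>. take (length (x # xs)) \<gamma> = x # xs \<and> take (length (y # ys)) (rev \<gamma>) = y # ys}
    = \<rho>0 ^ x * \<rho>1 ^ y * event_weight L (x # xs) (y # ys) / Z L"
  (is "measure _ ?A = _")
proof -
  have "measure (pathpmf L) ?A = measure (pathpmf L) (path_event L (x # xs) (y # ys))"
    using set_pathpmf[of L]
    by (intro measure_pmf.finite_measure_eq_AE) (auto simp: AE_measure_pmf_iff path_event_def)
  also have "\<dots> = (\<Sum>\<gamma>\<in>path_event L (x # xs) (y # ys). pmf (pathpmf L) \<gamma>)"
    by (intro measure_measure_pmf_finite finite_path_event)
  also have "\<dots> = (\<Sum>\<gamma>\<in>path_event L (x # xs) (y # ys). \<rho>0 ^ x * \<rho>1 ^ y / Z L * path_weight \<gamma>)"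
  proof (rule sum.cong)
    fix \<gamma> assume g: "\<gamma> \<in> path_event L (x # xs) (y # ys)"
    then have "\<gamma> \<in> motzkin_paths L" by (simp add: path_event_def)
    then show "pmf (pathpmf L) \<gamma> = \<rho>0 ^ x * \<rho>1 ^ y / Z L * path_weight \<gamma>"
      using path_event_hd_last[OF g] by (simp add: pmf_pathpmf motzkin_weight_eq)
  qed simp
  finally show ?thesis by (simp add: event_weight_def sum_distrib_left sum_divide_distrib)
qed

definition initial_const :: "real \<Rightarrow> real" where
  "initial_const \<rho> = Re (init_const \<sigma> q \<rho>)"

lemma initial_const_pos: "0 \<le> \<rho> \<Longrightarrow> \<rho> < 1 \<Longrightarrow> 0 < initial_const \<rho>"
  unfolding initial_const_def by (rule init_const_real)

definition initial_pmf :: "real \<Rightarrow> nat pmf" where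
  "initial_pmf \<rho> = embed_pmf (\<lambda>n. \<rho> ^ n * s n / initial_const \<rho>)"

lemma pmf_initial_pmf:
  assumes "0 \<le> \<rho>" "\<rho> < 1"
  shows "pmf (initial_pmf \<rho>) n = \<rho> ^ n * s n / initial_const \<rho>"
proof -
  have nn: "0 \<le> \<rho> ^ n * s n / initial_const \<rho>" for n
    using assms s_pos[of n] initial_const_pos[OF assms] by simp
  have "(\<lambda>n. \<rho> ^ n * s n / initial_const \<rho>) sums (initial_const \<rho> / initial_const \<rho>)"
    using init_const_real(1)[OF assms] unfolding initial_const_def by (rule sums_divide)
  then have "(\<lambda>n. \<rho> ^ n * s n / initial_const \<rho>) sums 1"
    using initial_const_pos[OF assms] by simp
  then have "(\<Sum>n. ennreal (\<rho> ^ n * s n / initial_const \<rho>)) = 1"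
    using nn by (simp add: suminf_ennreal2 sums_iff)
  then show ?thesis
    unfolding initial_pmf_def using nn
    by (intro pmf_embed_pmf) (auto simp: nn_integral_count_space_nat)
qed

text \<open>As these masses add up to 1, \<open>Z L\<close> becomes a double sum over the end
  heights without any rearrangement of the sum over paths; \<open>Z_ratio\<close> uses it
  so.\<close>

lemma pmf_endpoints:
  "pmf (map_pmf (\<lambda>\<gamma>. (\<gamma> ! 0, \<gamma> ! L)) (pathpmf L)) (m, n) = \<rho>0 ^ m * \<rho>1 ^ n * G L m n / Z L"
proof -
  have "pmf (map_pmf (\<lambda>\<gamma>. (\<gamma> ! 0, \<gamma> ! L)) (pathpmf L)) (m, n)
      = measure (pathpmf L) {\<gamma>. take (length [m]) \<gamma> = [m] \<and> take (length [n]) (rev \<gamma>) = [n]}"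
    unfolding pmf_map
  proof (rule measure_pmf.finite_measure_eq_AE)
    have "(\<gamma> \<in> (\<lambda>\<gamma>. (\<gamma> ! 0, \<gamma> ! L)) -` {(m, n)}) = (take (Suc 0) \<gamma> = [m] \<and> take (Suc 0) (rev \<gamma>) = [n])"
      if "\<gamma> \<in> motzkin_paths L" for \<gamma>
    proof -
      have len: "length \<gamma> = Suc L" using that by (simp add: motzkin_paths_def)
      then have "take (Suc 0) \<gamma> = [\<gamma> ! 0]" "take (Suc 0) (rev \<gamma>) = [rev \<gamma> ! 0]"
        by (simp_all add: take_Suc_conv_app_nth)
      then show ?thesis using len by (simp add: rev_nth)
    qed
    then show "AE \<gamma> in pathpmf L. (\<gamma> \<in> (\<lambda>\<gamma>. (\<gamma> ! 0, \<gamma> ! L)) -` {(m, n)}) =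
        (\<gamma> \<in> {\<gamma>. take (length [m]) \<gamma> = [m] \<and> take (length [n]) (rev \<gamma>) = [n]})"
      using set_pathpmf[of L] by (auto simp: AE_measure_pmf_iff)
  qed auto
  also have "\<dots> = \<rho>0 ^ m * \<rho>1 ^ n * G L m n / Z L"
    unfolding prob_path_event by (simp add: event_weight_singletons)
  finally show ?thesis .
qed

lemma Z_ratio: "(\<lambda>L. Z L / g L) \<longlonglongrightarrow> initial_const \<rho>0 * initial_const \<rho>1"
proof -
  \<comment> \<open>With \<tau> strictly between both boundary parameters and 1, the factor
    \<open>1 / (\<tau> ^ m * \<tau> ^ n)\<close> from \<open>G_domination\<close> still leaves a
    summable majorant.\<close>
  define \<tau> where "\<tau> = (1 + max \<rho>0 \<rho>1) / 2"
  have \<tau>: "0 < \<tau>" "\<tau> < 1" "\<rho>0 < \<tau>" "\<rho>1 < \<tau>" using \<rho> by (auto simp: \<tau>_def)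
  obtain C where C: "0 < C" "\<And>L m n. \<tau> ^ m * \<tau> ^ n * G L m n \<le> C * g L"
    using G_domination[OF \<tau>(1,2)] by blast
  define c0 c1 where "c0 = \<rho>0 / \<tau>" and "c1 = \<rho>1 / \<tau>"
  have c: "0 \<le> c0" "c0 < 1" "0 \<le> c1" "c1 < 1" using \<rho> \<tau> by (auto simp: c0_def c1_def)
  \<comment> \<open>The denominator undoes the normalization of the geometric laws: the majorant is
    \<open>C * c0 ^ m * c1 ^ n\<close>, integrable as a multiple of a pmf.\<close>
  let ?D = "C / ((1 - c0) * (1 - c1))"
  define f where "f L = (\<lambda>(m, n). \<rho>0 ^ m * \<rho>1 ^ n * (G L m n / g L))" for L
  define F where "F = (\<lambda>(m, n). \<rho>0 ^ m * \<rho>1 ^ n * (s m * s n))"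
  have intf: "(\<integral>x. f L x \<partial>count_space UNIV) = Z L / g L" for L
  proof -
    have "f L = (\<lambda>x. Z L / g L * pmf (map_pmf (\<lambda>\<gamma>. (\<gamma> ! 0, \<gamma> ! L)) (pathpmf L)) x)"
      using Z_pos[of L] by (auto simp: f_def pmf_endpoints fun_eq_iff)
    then show ?thesis by (simp add: integral_pmf)
  qed
  have intF: "(\<integral>x. F x \<partial>count_space UNIV) = initial_const \<rho>0 * initial_const \<rho>1"
  proof -
    have "F = (\<lambda>x. initial_const \<rho>0 * initial_const \<rho>1 * pmf (pair_pmf (initial_pmf \<rho>0) (initial_pmf \<rho>1)) x)"
      using initial_const_pos[of \<rho>0] initial_const_pos[of \<rho>1] \<rho>
      by (auto simp: F_def pmf_pair pmf_initial_pmf fun_eq_iff)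
    then show ?thesis by (simp add: integral_pmf)
  qed
  have "(\<lambda>L. \<integral>x. f L x \<partial>count_space UNIV) \<longlonglongrightarrow> (\<integral>x. F x \<partial>count_space UNIV)"
  proof (rule integral_dominated_convergence[where w = "\<lambda>x. ?D * pmf (pair_pmf (geometric_pmf (1 - c0)) (geometric_pmf (1 - c1))) x"])
    show "integrable (count_space UNIV) (\<lambda>x. ?D * pmf (pair_pmf (geometric_pmf (1 - c0)) (geometric_pmf (1 - c1))) x)"
      by (intro integrable_mult_right integrable_pmf)
    show "AE x in count_space UNIV. (\<lambda>L. f L x) \<longlonglongrightarrow> F x"
      by (intro AE_I2) (auto simp: f_def F_def simp del: times_divide_eq_right
          intro!: tendsto_mult tendsto_const G_ratio)
    fix L
    have "norm (f L (m, n)) \<le> ?D * pmf (pair_pmf (geometric_pmf (1 - c0)) (geometric_pmf (1 - c1))) (m, n)" for m n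
    proof -
      have "G L m n / g L \<le> C / (\<tau> ^ m * \<tau> ^ n)"
        using C(2)[of m n L] G_00_pos[of L] \<tau> by (simp add: divide_le_eq le_divide_eq mult_ac)
      then have "\<rho>0 ^ m * \<rho>1 ^ n * (G L m n / g L) \<le> \<rho>0 ^ m * \<rho>1 ^ n * (C / (\<tau> ^ m * \<tau> ^ n))"
        using \<rho> by (intro mult_left_mono) auto
      also have "\<dots> = C * c0 ^ m * c1 ^ n"
        by (simp add: c0_def c1_def power_divide)
      also have "\<dots> = ?D * pmf (pair_pmf (geometric_pmf (1 - c0)) (geometric_pmf (1 - c1))) (m, n)"
        using c by (simp add: pmf_pair)
      finally show ?thesis
        using \<rho> G_nonneg by (simp add: f_def)
    qed
    then show "AE x in count_space UNIV. norm (f L x) \<le> ?D * pmf (pair_pmf (geometric_pmf (1 - c0)) (geometric_pmf (1 - c1))) x"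
      by auto
  qed auto
  then show ?thesis by (simp add: intf intF)
qed

lemma g_shift_ratio: "(\<lambda>L. g (L + j) / g L) \<longlonglongrightarrow> lam ^ j"
proof (induction j)
  case 0
  then show ?case by (simp add: less_imp_neq[OF G_00_pos, symmetric])
next
  case (Suc j)
  have "(\<lambda>L. g (Suc (L + j)) / g (L + j) * (g (L + j) / g L)) \<longlonglongrightarrow> lam * lam ^ j"
    by (intro tendsto_mult Suc LIMSEQ_ignore_initial_segment[OF g_ratio])
  then show ?case by (simp add: less_imp_neq[OF G_00_pos, symmetric])
qed

text \<open>The law of an initial segment of the limit chain after telescoping: the initial factor
  \<open>s (hd xs)\<close> and the ratios of \<open>s\<close> along the list leave only
  \<open>s (last xs)\<close>.\<close>

definition chain_prob :: "real \<Rightarrow> nat list \<Rightarrow> real" where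
  "chain_prob \<rho> xs = \<rho> ^ hd xs * chain_weight xs * s (last xs) / (lam ^ (length xs - 1) * initial_const \<rho>)"

text \<open>At length \<open>L + k\<close>, with \<open>k\<close> the number of steps in the two
  segments, every factor is compared with \<open>g\<close>. The ratio limit of \<open>G\<close> is a
  product of a function of each end height; this is the asymptotic independence.\<close>

lemma prob_path_event_limit:
  assumes "xs \<noteq> []" "ys \<noteq> []"
  shows "(\<lambda>L. measure (pathpmf L) {\<gamma>. take (length xs) \<gamma> = xs \<and> take (length ys) (rev \<gamma>) = ys})
    \<longlonglongrightarrow> chain_prob \<rho>0 xs * chain_prob \<rho>1 ys"
proof -
  obtain x xs' y ys' where xs: "xs = x # xs'" and ys: "ys = y # ys'"
    using assms by (metis neq_Nil_conv)
  define k where "k = length ys' + length xs'"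
  have gne: "g L \<noteq> 0" for L using G_00_pos[of L] by simp
  have ev: "measure (pathpmf (L + k)) {\<gamma>. take (length xs) \<gamma> = xs \<and> take (length ys) (rev \<gamma>) = ys}
     = \<rho>0 ^ x * \<rho>1 ^ y * (chain_weight xs * chain_weight ys) *
       (G L (last xs) (last ys) / g L / (g (L + k) / g L) / (Z (L + k) / g (L + k)))" for L
    unfolding xs ys prob_path_event k_def add.assoc[symmetric] event_weight_eq
    using gne by simp
  have "(\<lambda>L. \<rho>0 ^ x * \<rho>1 ^ y * (chain_weight xs * chain_weight ys) *
       (G L (last xs) (last ys) / g L / (g (L + k) / g L) / (Z (L + k) / g (L + k))))
    \<longlonglongrightarrow> \<rho>0 ^ x * \<rho>1 ^ y * (chain_weight xs * chain_weight ys) *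
       (s (last xs) * s (last ys) / lam ^ k / (initial_const \<rho>0 * initial_const \<rho>1))"
    using lam_pos initial_const_pos[OF \<rho>(1,2)] initial_const_pos[OF \<rho>(3,4)]
    by (intro tendsto_intros G_ratio g_shift_ratio LIMSEQ_ignore_initial_segment[OF Z_ratio]) auto
  also have "\<rho>0 ^ x * \<rho>1 ^ y * (chain_weight xs * chain_weight ys) *
       (s (last xs) * s (last ys) / lam ^ k / (initial_const \<rho>0 * initial_const \<rho>1))
      = chain_prob \<rho>0 xs * chain_prob \<rho>1 ys"
    by (simp add: chain_prob_def xs ys k_def power_add mult_ac)
  finally show ?thesis
    unfolding ev[symmetric] by (rule LIMSEQ_offset)
qed

end

section \<open>Convergence of the laws\<close>

text \<open>Turns the joint law of the limit processes at finitely many times into a pmf, to which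
  \<open>tendsto_expectation_pmf\<close> applies.\<close>

lemma prob_space_countable_eq_pmf:
  fixes M :: "'a::countable measure"
  assumes "prob_space M" "sets M = UNIV"
  obtains p where "measure_pmf p = M"
proof -
  interpret prob_space M by fact
  define p where "p = embed_pmf (\<lambda>x. measure M {x})"
  have "(\<integral>\<^sup>+x. ennreal (measure M {x}) \<partial>count_space UNIV) = emeasure M UNIV"
    using assms by (subst emeasure_countable_singleton) (auto simp: emeasure_eq_measure)
  also have "\<dots> = 1"
    using sets_eq_imp_space_eq[of M "count_space UNIV"] assms emeasure_space_1 by simp
  finally have one: "(\<integral>\<^sup>+x. ennreal (measure M {x}) \<partial>count_space UNIV) = 1" .
  have pmf: "pmf p x = measure M {x}" for x
    unfolding p_def using one by (intro pmf_embed_pmf) auto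
  have "measure_pmf p = M"
    using assms pmf
    by (intro measure_eqI_countable[where A = UNIV])
       (auto simp: emeasure_pmf_single emeasure_eq_measure)
  then show ?thesis by (rule that)
qed

text \<open>Scheffe's lemma: on a discrete space, convergence of the point masses to a probability mass
  function is convergence in total variation.\<close>

lemma tendsto_expectation_pmf:
  fixes f :: "'a \<Rightarrow> real"
  assumes lim: "\<And>x. (\<lambda>n. pmf (p n) x) \<longlonglongrightarrow> pmf P x"
    and bdd: "\<And>x. \<bar>f x\<bar> \<le> B"
  shows "(\<lambda>n. measure_pmf.expectation (p n) f) \<longlonglongrightarrow> measure_pmf.expectation P f"
proof -
  have B: "0 \<le> B" using bdd[of undefined] by linarith
  have int_f: "integrable (count_space UNIV) (\<lambda>x. pmf r x * f x)" for r :: "'a pmf"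
  proof (rule Bochner_Integration.integrable_bound)
    show "integrable (count_space UNIV) (\<lambda>x. pmf r x * B)"
      by (intro integrable_mult_left integrable_pmf)
    show "AE x in count_space UNIV. norm (pmf r x * f x) \<le> norm (pmf r x * B)"
      using bdd B by (auto simp: abs_mult intro!: AE_I2 mult_left_mono)
  qed auto
  have E: "measure_pmf.expectation r f = (\<integral>x. pmf r x * f x \<partial>count_space UNIV)" for r :: "'a pmf"
    unfolding measure_pmf_eq_density by (subst integral_density) auto
  have diff: "integrable (count_space UNIV) (\<lambda>x. pmf (p n) x - pmf P x)" for n
    by (intro Bochner_Integration.integrable_diff integrable_pmf)
  have nn1: "(\<integral>\<^sup>+x. ennreal (norm (pmf r x)) \<partial>count_space UNIV) = 1" for r :: "'a pmf"
    using nn_integral_pmf[where A = UNIV and p = r] measure_pmf.emeasure_space_1[of r]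
    by (simp del: nn_integral_pmf)
  have "(\<lambda>n. \<integral>\<^sup>+x. norm (pmf (p n) x - pmf P x) \<partial>count_space UNIV) \<longlonglongrightarrow> 0"
  proof (rule Scheffe_lemma2)
    show "AE x in count_space UNIV. (\<lambda>n. pmf (p n) x) \<longlonglongrightarrow> pmf P x"
      by (intro AE_I2 lim)
    show "(\<integral>\<^sup>+x. ennreal (norm (pmf (p n) x)) \<partial>count_space UNIV)
        \<le> (\<integral>\<^sup>+x. ennreal (norm (pmf P x)) \<partial>count_space UNIV)" for n
      by (simp only: nn1 order_refl)
  qed (auto intro: integrable_pmf)
  moreover have "(\<integral>\<^sup>+x. norm (pmf (p n) x - pmf P x) \<partial>count_space UNIV)
      = ennreal (\<integral>x. norm (pmf (p n) x - pmf P x) \<partial>count_space UNIV)" for n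
    using diff by (intro nn_integral_eq_integral) auto
  ultimately have TV: "(\<lambda>n. \<integral>x. norm (pmf (p n) x - pmf P x) \<partial>count_space UNIV) \<longlonglongrightarrow> 0"
    by (simp add: ennreal_tendsto_0_iff)
  have "norm (measure_pmf.expectation (p n) f - measure_pmf.expectation P f)
      \<le> (\<integral>x. norm (pmf (p n) x - pmf P x) \<partial>count_space UNIV) * B" for n
  proof -
    have "measure_pmf.expectation (p n) f - measure_pmf.expectation P f
        = (\<integral>x. (pmf (p n) x - pmf P x) * f x \<partial>count_space UNIV)"
      unfolding E by (subst Bochner_Integration.integral_diff[symmetric, OF int_f int_f])
        (simp add: left_diff_distrib)
    also have "norm \<dots> \<le> (\<integral>x. norm ((pmf (p n) x - pmf P x) * f x) \<partial>count_space UNIV)"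
      by (rule integral_norm_bound)
    also have "\<dots> \<le> (\<integral>x. norm (pmf (p n) x - pmf P x) * B \<partial>count_space UNIV)"
    proof (rule integral_mono)
      show "integrable (count_space UNIV) (\<lambda>x. norm ((pmf (p n) x - pmf P x) * f x))"
        using Bochner_Integration.integrable_diff[OF int_f[of "p n"] int_f[of P]]
        by (intro integrable_norm) (simp add: left_diff_distrib)
      show "integrable (count_space UNIV) (\<lambda>x. norm (pmf (p n) x - pmf P x) * B)"
        using diff by (intro integrable_mult_left integrable_norm)
    qed (use bdd in \<open>auto simp: abs_mult intro!: mult_left_mono\<close>)
    finally show ?thesis by simp
  qed
  then have "\<forall>\<^sub>F n in sequentially. norm (measure_pmf.expectation (p n) f - measure_pmf.expectation P f)
      \<le> (\<integral>x. norm (pmf (p n) x - pmf P x) \<partial>count_space UNIV) * B"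
    by (intro always_eventually allI)
  moreover have "(\<lambda>n. (\<integral>x. norm (pmf (p n) x - pmf P x) \<partial>count_space UNIV) * B) \<longlonglongrightarrow> 0"
    using tendsto_mult[OF TV tendsto_const[of B]] by simp
  ultimately have "(\<lambda>n. measure_pmf.expectation (p n) f - measure_pmf.expectation P f) \<longlonglongrightarrow> 0"
    by (rule Lim_null_comparison)
  then show ?thesis by (simp add: LIM_zero_iff)
qed

lemma measurable_map_count_space:
  fixes X :: "nat \<Rightarrow> 'a \<Rightarrow> 'b::countable"
  assumes [measurable]: "\<And>k. X k \<in> measurable M (count_space UNIV)"
  shows "(\<lambda>\<omega>. map (\<lambda>t. X t \<omega>) ts) \<in> measurable M (count_space UNIV)"
proof (subst measurable_count_space_eq2_countable, safe)
  fix xs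
  have "(\<lambda>\<omega>. map (\<lambda>t. X t \<omega>) ts) -` {xs} \<inter> space M
    = {\<omega> \<in> space M. length xs = length ts \<and> (\<forall>i\<in>{..<length ts}. X (ts ! i) \<omega> = xs ! i)}"
    by (auto simp: list_eq_iff_nth_eq)
  also have "\<dots> \<in> sets M" by measurable
  finally show "(\<lambda>\<omega>. map (\<lambda>t. X t \<omega>) ts) -` {xs} \<inter> space M \<in> sets M" .
qed auto

lemma measurable_Pair_count_space:
  fixes f :: "'a \<Rightarrow> 'b::countable" and h :: "'a \<Rightarrow> 'c::countable"
  assumes [measurable]: "f \<in> measurable M (count_space UNIV)" "h \<in> measurable M (count_space UNIV)"
  shows "(\<lambda>\<omega>. (f \<omega>, h \<omega>)) \<in> measurable M (count_space UNIV)"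
proof (subst measurable_count_space_eq2_countable, safe)
  fix a b
  have "(\<lambda>\<omega>. (f \<omega>, h \<omega>)) -` {(a, b)} \<inter> space M = {\<omega> \<in> space M. f \<omega> = a \<and> h \<omega> = b}"
    by auto
  also have "\<dots> \<in> sets M" by measurable
  finally show "(\<lambda>\<omega>. (f \<omega>, h \<omega>)) -` {(a, b)} \<inter> space M \<in> sets M" .
qed auto

lemma map_eq_iff_upt:
  "length xs = Suc k \<Longrightarrow> map f [0..<Suc k] = xs \<longleftrightarrow> (\<forall>j\<le>k. f j = xs ! j)"
  by (auto simp: list_eq_iff_nth_eq less_Suc_eq_le simp del: upt_Suc)

lemma indep_processes_prob:
  assumes M: "prob_space M" and indep: "indep_processes M X Y"
  shows "measure M {\<omega> \<in> space M. (\<forall>j\<le>k. X j \<omega> = x j) \<and> (\<forall>j\<le>k. Y j \<omega> = y j)}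
    = measure M {\<omega> \<in> space M. \<forall>j\<le>k. X j \<omega> = x j} * measure M {\<omega> \<in> space M. \<forall>j\<le>k. Y j \<omega> = y j}"
proof -
  interpret prob_space M by fact
  let ?P = "\<Pi>\<^sub>M k\<in>UNIV :: nat set. count_space (UNIV :: nat set)"
  let ?A = "\<lambda>x :: nat \<Rightarrow> nat. {f \<in> space ?P. \<forall>j\<in>{..k}. f j = x j}"
  have A: "?A x \<in> sets ?P" for x
    by measurable
  have sp: "space ?P = UNIV" by (simp add: space_PiM)
  have "prob ((\<lambda>\<omega>. ((\<lambda>k. X k \<omega>), (\<lambda>k. Y k \<omega>))) -` (?A x \<times> ?A y) \<inter> space M)
      = prob ((\<lambda>\<omega> k. X k \<omega>) -` ?A x \<inter> space M) * prob ((\<lambda>\<omega> k. Y k \<omega>) -` ?A y \<inter> space M)"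
    using indep unfolding indep_processes_def by (rule indep_varD) (rule A)+
  moreover have "(\<lambda>\<omega>. ((\<lambda>k. X k \<omega>), (\<lambda>k. Y k \<omega>))) -` (?A x \<times> ?A y) \<inter> space M
      = {\<omega> \<in> space M. (\<forall>j\<le>k. X j \<omega> = x j) \<and> (\<forall>j\<le>k. Y j \<omega> = y j)}"
    by (auto simp: sp)
  moreover have "(\<lambda>\<omega> k. X k \<omega>) -` ?A x \<inter> space M = {\<omega> \<in> space M. \<forall>j\<le>k. X j \<omega> = x j}"
    "(\<lambda>\<omega> k. Y k \<omega>) -` ?A y \<inter> space M = {\<omega> \<in> space M. \<forall>j\<le>k. Y j \<omega> = y j}"
    by (auto simp: sp)
  ultimately show ?thesis by simp
qed

section \<open>The limit chain and the finite-dimensional laws\<close>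

context motzkin_boundary
begin

definition kernel_pmf :: "nat \<Rightarrow> nat pmf" where
  "kernel_pmf n = embed_pmf (\<lambda>m. w n * step_weight n m * s m / (lam * s n))"

text \<open>The total mass is \<open>w n * hop s n / (lam * s n)\<close>, which is 1 because of the
  eigenvector equation \<open>hop_s\<close>.\<close>

lemma pmf_kernel_pmf: "pmf (kernel_pmf n) m = w n * step_weight n m * s m / (lam * s n)"
proof -
  let ?f = "\<lambda>m. w n * step_weight n m * s m / (lam * s n)"
  have nn: "0 \<le> ?f m" for m
    using w_pos[of n] s_pos[of n] s_pos[of m] lam_pos \<sigma> by (simp add: step_weight_def)
  have "?f sums (\<Sum>m\<in>{n-1..Suc n}. ?f m)"
    by (rule sums_finite) (auto simp: step_weight_def)
  also have "(\<Sum>m\<in>{n-1..Suc n}. ?f m) = w n * hop s n / (lam * s n)"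
    unfolding hop_eq_sum sum_distrib_left sum_divide_distrib by (simp only: mult.assoc)
  also have "\<dots> = 1"
    using w_pos[of n] s_pos[of n] lam_pos by (simp add: hop_s)
  finally have "(\<Sum>m. ennreal (?f m)) = 1"
    using nn by (simp add: suminf_ennreal2 sums_iff)
  then show ?thesis
    unfolding kernel_pmf_def using nn
    by (intro pmf_embed_pmf) (auto simp: nn_integral_count_space_nat)
qed

lemma pmf_kernel_pmf_eq_step_prob:
  "complex_of_real (pmf (kernel_pmf n) m) = step_prob \<sigma> q n (int m - int n)"
proof -
  \<comment> \<open>The 2 cancels the halves in the up and down probabilities and turns \<sigma>
    into the horizontal weight \<open>2 * \<sigma>\<close>.\<close>
  have fac: "(1 - q ^ (n + 1)) / (1 + \<sigma>) = 2 * w n / lam"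
    using q \<sigma> by (simp add: lam_def w_eq divide_simps del: power_Suc) (simp add: algebra_simps)
  consider "m = Suc n" | "m = n" | "n = Suc m" | "int m - int n \<notin> {-1, 0, 1}"
    by (smt (verit) insertE singletonD of_nat_Suc of_nat_eq_iff)
  then show ?thesis
  proof cases
    case 1
    then have "step_prob \<sigma> q n (int m - int n) = complex_of_real (2 * w n / lam * (s m / (2 * s n)))"
      using s_seq_eq[of m] s_seq_eq[of n] unfolding step_prob_def fac by (simp add: add.commute)
    then show ?thesis using 1 by (simp add: pmf_kernel_pmf step_weight_def)
  next
    case 2
    then show ?thesis
      using s_pos[of n] unfolding step_prob_def fac by (simp add: pmf_kernel_pmf step_weight_def)
  next
    case 3
    then have "step_prob \<sigma> q n (int m - int n) = complex_of_real (2 * w n / lam * (s m / (2 * s n)))"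
      using s_seq_eq[of m] s_seq_eq[of n] unfolding step_prob_def fac by simp
    then show ?thesis using 3 by (simp add: pmf_kernel_pmf step_weight_def)
  next
    case 4
    then have "step_weight n m = 0" using step_weight_nonzero by blast
    then show ?thesis using 4 by (simp add: pmf_kernel_pmf step_prob_def)
  qed
qed

lemma pmf_initial_pmf_eq_init_prob:
  assumes "0 \<le> \<rho>" "\<rho> < 1"
  shows "complex_of_real (pmf (initial_pmf \<rho>) n) = init_prob \<sigma> q \<rho> n"
  unfolding init_prob_def pmf_initial_pmf[OF assms] initial_const_def
  by (subst init_const_real(2)[OF assms]) (simp add: s_seq_eq)

lemma chain_prob_singleton:
  assumes "0 \<le> \<rho>" "\<rho> < 1"
  shows "chain_prob \<rho> [x] = pmf (initial_pmf \<rho>) x"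
  by (simp add: chain_prob_def pmf_initial_pmf[OF assms])

lemma chain_prob_snoc:
  assumes "xs \<noteq> []"
  shows "chain_prob \<rho> (xs @ [x]) = chain_prob \<rho> xs * pmf (kernel_pmf (last xs)) x"
proof -
  obtain k where k: "length xs = Suc k" using assms by (cases xs) auto
  show ?thesis
    using assms s_pos[of "last xs"] lam_pos k
    by (simp add: chain_prob_def chain_weight_snoc pmf_kernel_pmf mult_ac)
qed

lemma markov_chain_prob:
  assumes mc: "markov_chain M X (initial_pmf \<rho>) kernel_pmf" and \<rho>': "0 \<le> \<rho>" "\<rho> < 1"
  shows "measure M {\<omega> \<in> space M. \<forall>j\<le>k. X j \<omega> = x j} = chain_prob \<rho> (map x [0..<Suc k])"
proof -
  interpret prob_space M using mc by (simp add: markov_chain_def)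
  have [measurable]: "X k \<in> measurable M (count_space UNIV)" for k
    using mc by (simp add: markov_chain_def)
  have init: "measure M {\<omega> \<in> space M. X 0 \<omega> = n} = pmf (initial_pmf \<rho>) n" for n
    using mc by (simp add: markov_chain_def)
  have trans: "measure M {\<omega> \<in> space M. \<forall>j\<le>k. X j \<omega> = x j} > 0 \<Longrightarrow>
      cond_prob M (\<lambda>\<omega>. X (Suc k) \<omega> = m) (\<lambda>\<omega>. \<forall>j\<le>k. X j \<omega> = x j) = pmf (kernel_pmf (x k)) m" for k m
    using mc by (simp add: markov_chain_def)
  show ?thesis
  proof (induction k)
    case 0
    then show ?case using init[of "x 0"] chain_prob_singleton[OF \<rho>'] by simp
  next
    case (Suc k)
    let ?H = "{\<omega> \<in> space M. \<forall>j\<le>k. X j \<omega> = x j}"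
    let ?J = "{\<omega> \<in> space M. X (Suc k) \<omega> = x (Suc k) \<and> (\<forall>j\<le>k. X j \<omega> = x j)}"
    have eq: "{\<omega> \<in> space M. \<forall>j\<le>Suc k. X j \<omega> = x j} = ?J"
      by (auto simp: le_Suc_eq)
    have "measure M ?J = measure M ?H * pmf (kernel_pmf (x k)) (x (Suc k))"
    proof (cases "measure M ?H > 0")
      case True
      then show ?thesis using trans[OF True, of "x (Suc k)"] by (simp add: cond_prob_def field_simps)
    next
      \<comment> \<open>The chain property says nothing after a history of probability zero, but
        then both sides are zero.\<close>
      case False
      have "measure M ?J \<le> measure M ?H"
        by (rule finite_measure_mono) auto
      then show ?thesis using False by (simp add: zero_less_measure_iff antisym)
    qed
    then show ?case
      unfolding eq using Suc chain_prob_snoc[of "map x [0..<Suc k]" \<rho> "x (Suc k)"] by simp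
  qed
qed

text \<open>Once \<open>L \<ge> k\<close>, the zero padding of the two sequences is out of reach and
  \<open>prob_path_event_limit\<close> applies; the finitely many other \<open>L\<close> do not
  affect the limit.\<close>

lemma tendsto_pmf_path_ends:
  fixes k :: nat
  defines "H \<equiv> \<lambda>L \<gamma>. (map (path_seq L \<gamma>) [0..<Suc k], map (rev_path_seq L \<gamma>) [0..<Suc k])"
  assumes "length xs = Suc k" "length ys = Suc k"
  shows "(\<lambda>L. pmf (map_pmf (H L) (pathpmf L)) (xs, ys)) \<longlonglongrightarrow> chain_prob \<rho>0 xs * chain_prob \<rho>1 ys"
proof -
  have "pmf (map_pmf (H L) (pathpmf L)) (xs, ys)
      = measure (pathpmf L) {\<gamma>. take (length xs) \<gamma> = xs \<and> take (length ys) (rev \<gamma>) = ys}" if "L \<ge> k" for L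
    unfolding pmf_map
  proof (rule measure_pmf.finite_measure_eq_AE)
    have "H L \<gamma> = (take (Suc k) \<gamma>, take (Suc k) (rev \<gamma>))" if "\<gamma> \<in> motzkin_paths L" for \<gamma>
    proof -
      have len: "length \<gamma> = Suc L" using that by (simp add: motzkin_paths_def)
      have "map (path_seq L \<gamma>) [0..<Suc k] = take (Suc k) \<gamma>"
        using len \<open>k \<le> L\<close> by (intro nth_equalityI) (auto simp: path_seq_def simp del: upt_Suc)
      moreover have "map (rev_path_seq L \<gamma>) [0..<Suc k] = take (Suc k) (rev \<gamma>)"
        using len \<open>k \<le> L\<close> by (intro nth_equalityI) (auto simp: rev_path_seq_def rev_nth simp del: upt_Suc)
      ultimately show ?thesis by (simp only: H_def)
    qed
    then show "AE \<gamma> in pathpmf L. (\<gamma> \<in> H L -` {(xs, ys)}) =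
        (\<gamma> \<in> {\<gamma>. take (length xs) \<gamma> = xs \<and> take (length ys) (rev \<gamma>) = ys})"
      using set_pathpmf[of L] assms(2,3) by (auto simp: AE_measure_pmf_iff)
  qed auto
  then have "\<forall>\<^sub>F L in sequentially. measure (pathpmf L) {\<gamma>. take (length xs) \<gamma> = xs \<and> take (length ys) (rev \<gamma>) = ys}
      = pmf (map_pmf (H L) (pathpmf L)) (xs, ys)"
    by (intro eventually_sequentiallyI[of k]) (rule sym)
  then show ?thesis
    using assms(2,3) by (intro Lim_transform_eventually[OF prob_path_event_limit]) auto
qed

text \<open>The times in \<open>ts\<close> and \<open>us\<close> are read off by
  \<open>\<phi>\<close> from complete initial segments up to a common bound \<open>k\<close>, whose
  point masses are known. As \<open>f\<close> composed with \<open>\<phi>\<close> is still bounded,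
  convergence of the point masses suffices.\<close>

lemma fin_dim_law_converges:
  fixes ts us :: "nat list"
  assumes N: "\<And>L. L \<ge> 1 \<Longrightarrow> \<Gamma> L \<in> measurable (N L) (count_space UNIV)"
      "\<And>L. L \<ge> 1 \<Longrightarrow> distr (N L) (count_space UNIV) (\<Gamma> L) = measure_pmf (pathpmf L)"
    and X: "markov_chain M X (initial_pmf \<rho>0) kernel_pmf"
    and Y: "markov_chain M Y (initial_pmf \<rho>1) kernel_pmf"
    and indep: "indep_processes M X Y"
  shows "weak_conv_on (discrete_topology UNIV)
    (\<lambda>L. fin_dim_law (N L) (\<lambda>k \<omega>. path_seq L (\<Gamma> L \<omega>) k) (\<lambda>k \<omega>. rev_path_seq L (\<Gamma> L \<omega>) k) ts us)
    (fin_dim_law M X Y ts us)"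
  unfolding weak_conv_on_def
proof (intro allI impI)
  fix f :: "nat list \<times> nat list \<Rightarrow> real"
  assume "continuous_map (discrete_topology UNIV) euclideanreal f \<and> bounded (f ` topspace (discrete_topology UNIV))"
  then obtain B where B: "\<And>x. \<bar>f x\<bar> \<le> B"
    by (auto simp: bounded_iff)
  interpret prob_space M using X by (simp add: markov_chain_def)
  have meas: "X k \<in> measurable M (count_space UNIV)" "Y k \<in> measurable M (count_space UNIV)" for k
    using X Y by (auto simp: markov_chain_def)
  obtain k where k: "set ts \<subseteq> {..k}" "set us \<subseteq> {..k}"
    using finite_nat_set_iff_bounded_le[of "set ts \<union> set us"] by auto
  define \<phi> where "\<phi> = (\<lambda>(xs, ys). (map ((!) xs) ts, map ((!) ys) us) :: nat list \<times> nat list)"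
  define H where "H L \<gamma> = (map (path_seq L \<gamma>) [0..<Suc k], map (rev_path_seq L \<gamma>) [0..<Suc k])" for L \<gamma>
  define J where "J \<omega> = (map (\<lambda>t. X t \<omega>) [0..<Suc k], map (\<lambda>t. Y t \<omega>) [0..<Suc k])" for \<omega>
  have \<phi>: "\<phi> (map a [0..<Suc k], map b [0..<Suc k]) = (map a ts, map b us)" for a b :: "nat \<Rightarrow> nat"
  proof -
    have "map a [0..<Suc k] ! t = a t" if "t \<le> k" for a :: "nat \<Rightarrow> nat" and t
      using that nth_map_upt[of t "Suc k" 0 a] by (simp del: upt_Suc)
    then show ?thesis using k by (auto simp: \<phi>_def simp del: upt_Suc)
  qed
  have J: "J \<in> measurable M (count_space UNIV)"
    unfolding J_def by (intro measurable_Pair_count_space measurable_map_count_space meas)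
  have "prob_space (distr M (count_space UNIV) J)"
    using J by (rule prob_space_distr)
  then obtain P where P: "measure_pmf P = distr M (count_space UNIV) J"
    by (rule prob_space_countable_eq_pmf) simp
  have pmf_P: "pmf P z = measure M (J -` {z} \<inter> space M)" for z
    by (simp add: measure_pmf_single[symmetric] P measure_distr J)
  have "(\<lambda>L. pmf (map_pmf (H L) (pathpmf L)) z) \<longlonglongrightarrow> pmf P z" for z
  proof -
    obtain xs ys where z: "z = (xs, ys)" by (cases z)
    show ?thesis
    proof (cases "length xs = Suc k \<and> length ys = Suc k")
      case True
      have m: "map ((!) xs) [0..<Suc k] = xs" "map ((!) ys) [0..<Suc k] = ys"
        using True map_nth[of xs] map_nth[of ys] by auto
      have "J -` {z} \<inter> space M = {\<omega> \<in> space M. (\<forall>j\<le>k. X j \<omega> = xs ! j) \<and> (\<forall>j\<le>k. Y j \<omega> = ys ! j)}"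
        using True by (auto simp: J_def z map_eq_iff_upt simp del: upt_Suc)
      then have "pmf P z = chain_prob \<rho>0 xs * chain_prob \<rho>1 ys"
        unfolding pmf_P
        using indep_processes_prob[OF prob_space_axioms indep, of k "(!) xs" "(!) ys"]
          markov_chain_prob[OF X \<rho>(1,2), of k "(!) xs"] markov_chain_prob[OF Y \<rho>(3,4), of k "(!) ys"]
        by (simp only: m)
      then show ?thesis
        using tendsto_pmf_path_ends[of xs k ys] True unfolding z H_def[abs_def] by simp
    next
      case False
      \<comment> \<open>Lists of the wrong length have mass zero for every \<open>L\<close> and in
        the limit.\<close>
      then have Jz: "J -` {z} = {}" and Hz: "z \<noteq> H L \<gamma>" for L \<gamma>
        by (auto simp: J_def H_def z)
      have "pmf P z = 0" by (simp add: pmf_P Jz)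
      moreover have "z \<notin> set_pmf (map_pmf (H L) (pathpmf L))" for L using Hz by auto
      ultimately have "pmf P z = 0" "pmf (map_pmf (H L) (pathpmf L)) z = 0" for L
        by (simp_all only: set_pmf_iff not_not)
      then show ?thesis by simp
    qed
  qed
  then have lim: "(\<lambda>L. measure_pmf.expectation (map_pmf (H L) (pathpmf L)) (\<lambda>z. f (\<phi> z)))
      \<longlonglongrightarrow> measure_pmf.expectation P (\<lambda>z. f (\<phi> z))"
    by (rule tendsto_expectation_pmf) (rule B)
  have law: "(\<integral>z. f z \<partial>fin_dim_law M X Y ts us) = measure_pmf.expectation P (\<lambda>z. f (\<phi> z))"
  proof -
    have "(\<integral>z. f z \<partial>fin_dim_law M X Y ts us) = (\<integral>\<omega>. f (map (\<lambda>t. X t \<omega>) ts, map (\<lambda>t. Y t \<omega>) us) \<partial>M)"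
      unfolding fin_dim_law_def
      by (intro integral_distr measurable_Pair_count_space measurable_map_count_space meas) simp
    also have "\<dots> = (\<integral>\<omega>. f (\<phi> (J \<omega>)) \<partial>M)" by (simp only: J_def \<phi>)
    also have "\<dots> = measure_pmf.expectation P (\<lambda>z. f (\<phi> z))"
      unfolding P using J by (intro integral_distr[symmetric]) auto
    finally show ?thesis .
  qed
  have "(\<integral>z. f z \<partial>fin_dim_law (N L) (\<lambda>k \<omega>. path_seq L (\<Gamma> L \<omega>) k) (\<lambda>k \<omega>. rev_path_seq L (\<Gamma> L \<omega>) k) ts us)
     = measure_pmf.expectation (map_pmf (H L) (pathpmf L)) (\<lambda>z. f (\<phi> z))" if L: "L \<ge> 1" for L
  proof -
    have "(\<lambda>\<omega>. (map (path_seq L (\<Gamma> L \<omega>)) ts, map (rev_path_seq L (\<Gamma> L \<omega>)) us)) \<in> measurable (N L) (count_space UNIV)"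
      by (rule measurable_compose[OF N(1)[OF L]]) simp
    then have "(\<integral>z. f z \<partial>fin_dim_law (N L) (\<lambda>k \<omega>. path_seq L (\<Gamma> L \<omega>) k) (\<lambda>k \<omega>. rev_path_seq L (\<Gamma> L \<omega>) k) ts us)
      = (\<integral>\<omega>. f (map (path_seq L (\<Gamma> L \<omega>)) ts, map (rev_path_seq L (\<Gamma> L \<omega>)) us) \<partial>N L)"
      unfolding fin_dim_law_def by (intro integral_distr) auto
    also have "\<dots> = (\<integral>\<omega>. f (\<phi> (H L (\<Gamma> L \<omega>))) \<partial>N L)" by (simp only: H_def \<phi>)
    also have "\<dots> = (\<integral>\<gamma>. f (\<phi> (H L \<gamma>)) \<partial>distr (N L) (count_space UNIV) (\<Gamma> L))"
      using N(1)[OF L] by (intro integral_distr[symmetric]) auto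
    also have "\<dots> = measure_pmf.expectation (map_pmf (H L) (pathpmf L)) (\<lambda>z. f (\<phi> z))"
      unfolding N(2)[OF L] by simp
    finally show ?thesis .
  qed
  then have "\<forall>\<^sub>F L in sequentially. measure_pmf.expectation (map_pmf (H L) (pathpmf L)) (\<lambda>z. f (\<phi> z))
     = (\<integral>z. f z \<partial>fin_dim_law (N L) (\<lambda>k \<omega>. path_seq L (\<Gamma> L \<omega>) k) (\<lambda>k \<omega>. rev_path_seq L (\<Gamma> L \<omega>) k) ts us)"
    by (intro eventually_sequentiallyI[of 1]) (rule sym)
  then show "(\<lambda>L. \<integral>z. f z \<partial>fin_dim_law (N L) (\<lambda>k \<omega>. path_seq L (\<Gamma> L \<omega>) k) (\<lambda>k \<omega>. rev_path_seq L (\<Gamma> L \<omega>) k) ts us)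
      \<longlonglongrightarrow> (\<integral>z. f z \<partial>fin_dim_law M X Y ts us)"
    unfolding law by (rule Lim_transform_eventually[OF lim])
qed

end

theorem theorem1p1:
  fixes \<rho>0 \<rho>1 \<sigma> q :: real
    and N :: "nat \<Rightarrow> 'b measure"
    and \<Gamma> :: "nat \<Rightarrow> 'b \<Rightarrow> nat list"
  assumes "0 \<le> \<rho>0" "\<rho>0 < 1"
    and "0 \<le> \<rho>1" "\<rho>1 < 1"
    and "0 \<le> q" "q < 1"
    and "0 < \<sigma>" "\<sigma> \<le> 1"
    and "\<And>L. L \<ge> 1 \<Longrightarrow> prob_space (N L)"
    and "\<And>L. L \<ge> 1 \<Longrightarrow> \<Gamma> L \<in> measurable (N L) (count_space UNIV)"
    and "\<And>L. L \<ge> 1 \<Longrightarrow>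
      distr (N L) (count_space UNIV) (\<Gamma> L) = measure_pmf (motzkin_pmf \<rho>0 \<rho>1 \<sigma> q L)"
  shows "\<exists>(\<mu>0 :: nat pmf) (\<mu>1 :: nat pmf) (\<kappa> :: nat \<Rightarrow> nat pmf).
    (\<forall>n. complex_of_real (pmf \<mu>0 n) = init_prob \<sigma> q \<rho>0 n) \<and>
    (\<forall>n. complex_of_real (pmf \<mu>1 n) = init_prob \<sigma> q \<rho>1 n) \<and>
    (\<forall>n m. complex_of_real (pmf (\<kappa> n) m) = step_prob \<sigma> q n (int m - int n)) \<and>
    (\<forall>(M :: 'a measure) X Y.
       markov_chain M X \<mu>0 \<kappa> \<and> markov_chain M Y \<mu>1 \<kappa> \<and> indep_processes M X Y \<longrightarrow>
       fin_dim_converges N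
         (\<lambda>L k \<omega>. path_seq L (\<Gamma> L \<omega>) k)
         (\<lambda>L k \<omega>. rev_path_seq L (\<Gamma> L \<omega>) k)
         M X Y)"
proof -
  interpret motzkin_boundary \<sigma> q \<rho>0 \<rho>1
    by standard (use assms in auto)
  show ?thesis
  \<comment> \<open>The equations for these witnesses also show that the complex formulas
    \<open>init_prob\<close> and \<open>step_prob\<close> take real values.\<close>
  proof (rule exI[of _ "initial_pmf \<rho>0"], rule exI[of _ "initial_pmf \<rho>1"], rule exI[of _ kernel_pmf],
      intro conjI allI impI)
    fix M :: "'a measure" and X Y
    assume "markov_chain M X (initial_pmf \<rho>0) kernel_pmf \<and> markov_chain M Y (initial_pmf \<rho>1) kernel_pmf
      \<and> indep_processes M X Y"
    then show "fin_dim_converges N (\<lambda>L k \<omega>. path_seq L (\<Gamma> L \<omega>) k) (\<lambda>L k \<omega>. rev_path_seq L (\<Gamma> L \<omega>) k) M X Y"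
      unfolding fin_dim_converges_def using assms(10,11) by (intro allI fin_dim_law_converges) auto
  qed (use assms in \<open>auto intro: pmf_initial_pmf_eq_init_prob pmf_kernel_pmf_eq_step_prob\<close>)
qed

end
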